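(* Let $d\geq 3$ be odd, and let Alice and Bob hold systems $A$ and $B$, each with Hilbert space $\mathbb{C}^d$ and standard orthonormal basis $|0\rangle,\dots,|d-1\rangle$. Let $\mathcal{U}_d\subset\mathbb{C}^d\otimes\mathbb{C}^d$ be the set of $(d-1)^2+1$ mutually orthogonal (unnormalized) product states consisting of, for each $t=0,1,\dots,\frac{d-3}{2}$ and each $k=1,\dots,d-2-2t$, with $\omega_t=e^{2\pi i/(d-1-2t)}$, the four states $$|t\rangle\otimes\sum_{j=t}^{d-2-t}\omega_t^{jk}|j\rangle,\qquad \Big(\sum_{j=t}^{d-2-t}\omega_t^{jk}|j\rangle\Big)\otimes|d-1-t\rangle,$$ $$|d-1-t\rangle\otimes\sum_{j=t+1}^{d-1-t}\omega_t^{jk}|j\rangle,\qquad \Big(\sum_{j=t+1}^{d-1-t}\omega_t^{jk}|j\rangle\Big)\otimes|t\rangle,$$ together with the stopper state $|F\rangle=\Big(\sum_{j=0}^{d-1}|j\rangle\Big)\otimes\Big(\sum_{j=0}^{d-1}|j\rangle\Big)$. Then the states of $\mathcal{U}_d$ can be perfectly distinguished by LOCC with the assistance of $\frac{d-1}{2}$ copies of a $2\otimes 2$ maximally entangled state shared between Alice and Bob.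
   Context: The first tensor factor belongs to Alice, the second to Bob; $i=\sqrt{-1}$ in the definition of $\omega_t$; normalization constants and global phases are ignored. A $2\otimes 2$ maximally entangled state is the state (proportional to) $|00\rangle+|11\rangle\in\mathbb{C}^2\otimes\mathbb{C}^2$. By $r$ copies is meant the shared state $|\Psi\rangle=\bigotimes_{l=1}^{r}|\Psi\rangle_{a_lb_l}$ with each factor $|00\rangle+|11\rangle$, where Alice holds $a=a_1\cdots a_r$ and Bob holds $b=b_1\cdots b_r$. LOCC (local operations and classical communication): a protocol consists of finitely many rounds; in each round one of the parties performs a quantum measurement (Kraus operators $\{M_x\}$ with $\sum_x M_x^\dagger M_x=I$) acting only on that party's own systems, the choice of the measurement being allowed to depend on all previous outcomes, and the outcome is communicated to the other party. A finite set $S$ of pairwise orthogonal states of $AB$ is perfectly distinguished by LOCC with the assistance of a shared entangled state $|\Psi\rangle_{ab}$ if there is an LOCC protocol, in which Alice acts on $aA$ and Bob acts on $bB$, such that when it is applied to $|\phi\rangle_{AB}\otimes|\Psi\rangle_{ab}$ with $|\phi\rangle\in S$ unknown, the sequence of measurement outcomes determines $|\phi\rangle$ with certainty; i.e. for every complete sequence of outcomes, at most one $|\phi\rangle\in S$ gives it nonzero probability. *)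

theory Defs
  imports Complex_Main "Jordan_Normal_Form.Schur_Decomposition"
begin

section \<open>Bipartite pure states\<close>

text \<open>
  A (not necessarily normalised) vector of \<open>\<complex>\<^sup>m \<otimes> \<complex>\<^sup>n\<close>, the first factor held by Alice and the
  second by Bob, is represented by its \<open>m \<times> n\<close> matrix of coefficients: the matrix \<open>\<psi>\<close> stands for
  the sum of \<open>\<psi> $$ (i, j) |i\<rangle> \<otimes> |j\<rangle>\<close> over \<open>i < m\<close>, \<open>j < n\<close>.
\<close>

definition prod_state :: "complex vec \<Rightarrow> complex vec \<Rightarrow> complex mat" where
  "prod_state u v = mat (dim_vec u) (dim_vec v) (\<lambda>(i, j). u $ i * v $ j)"

definition state_inner :: "complex mat \<Rightarrow> complex mat \<Rightarrow> complex" where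
  "state_inner \<phi> \<psi> = (\<Sum>i<dim_row \<phi>. \<Sum>j<dim_col \<phi>. cnj (\<phi> $$ (i, j)) * \<psi> $$ (i, j))"

definition orthogonal_states :: "complex mat set \<Rightarrow> bool" where
  "orthogonal_states S \<longleftrightarrow> pairwise (\<lambda>\<phi> \<psi>. state_inner \<phi> \<psi> = 0) S"

text \<open>
  For coefficient matrices \<open>\<Psi>\<close> of a state of \<open>ab\<close> and \<open>\<phi>\<close> of a state of \<open>AB\<close>, the Kronecker product
  is the coefficient matrix of \<open>|\<Psi>\<rangle>\<^sub>a\<^sub>b \<otimes> |\<phi>\<rangle>\<^sub>A\<^sub>B\<close> regarded as a state of \<open>(aA)(bB)\<close>: the row index
  \<open>i div dim_row \<phi>\<close>, \<open>i mod dim_row \<phi>\<close> encodes a basis vector of \<open>aA\<close>, the column index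
  one of \<open>bB\<close>.
\<close>

definition joint_state :: "complex mat \<Rightarrow> complex mat \<Rightarrow> complex mat" where
  "joint_state \<Psi> \<phi> =
     mat (dim_row \<Psi> * dim_row \<phi>) (dim_col \<Psi> * dim_col \<phi>)
       (\<lambda>(i, j). \<Psi> $$ (i div dim_row \<phi>, j div dim_col \<phi>) * \<phi> $$ (i mod dim_row \<phi>, j mod dim_col \<phi>))"

definition bell_pair :: "complex mat" where
  "bell_pair = prod_state (unit_vec 2 0) (unit_vec 2 0) + prod_state (unit_vec 2 1) (unit_vec 2 1)"

text \<open>Zero copies are the unit of the tensor product, the scalar \<open>1\<close> in \<open>\<complex>\<^sup>1 \<otimes> \<complex>\<^sup>1\<close>.\<close>

primrec bell_copies :: "nat \<Rightarrow> complex mat" where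
  "bell_copies 0 = 1\<^sub>m 1"
| "bell_copies (Suc r) = joint_state bell_pair (bell_copies r)"


section \<open>LOCC protocols\<close>

datatype party = Alice | Bob

text \<open>
  A protocol is a finite tree.  At a node the named party measures with the listed Kraus operators;
  outcome \<open>x\<close> is the \<open>x\<close>-th entry of the list, and its subtree is the rest of the protocol, so every
  later choice may depend on all previous outcomes.
\<close>

datatype protocol = Done | Measure party "(complex mat \<times> protocol) list"

definition measurement :: "nat \<Rightarrow> complex mat list \<Rightarrow> bool" where
  "measurement n Ms \<longleftrightarrow>
     set Ms \<subseteq> carrier_mat n n \<and>
     foldr (+) (map (\<lambda>M. mat_adjoint M * M) Ms) (0\<^sub>m n n) = 1\<^sub>m n"

fun locc_protocol :: "nat \<Rightarrow> nat \<Rightarrow> protocol \<Rightarrow> bool" where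
  "locc_protocol m n Done \<longleftrightarrow> True"
| "locc_protocol m n (Measure p bs) \<longleftrightarrow>
     measurement (case p of Alice \<Rightarrow> m | Bob \<Rightarrow> n) (map fst bs) \<and>
     (\<forall>b\<in>set bs. locc_protocol m n (snd b))"

fun complete_outcomes :: "protocol \<Rightarrow> nat list \<Rightarrow> bool" where
  "complete_outcomes Done xs \<longleftrightarrow> xs = []"
| "complete_outcomes (Measure p bs) [] \<longleftrightarrow> False"
| "complete_outcomes (Measure p bs) (x # xs) \<longleftrightarrow>
     x < length bs \<and> complete_outcomes (snd (bs ! x)) xs"

text \<open>On coefficient matrices, \<open>M \<otimes> I\<close> acts as \<open>\<psi> \<mapsto> M \<psi>\<close> and \<open>I \<otimes> M\<close> as \<open>\<psi> \<mapsto> \<psi> M\<^sup>T\<close>.\<close>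

fun local_op :: "party \<Rightarrow> complex mat \<Rightarrow> complex mat \<Rightarrow> complex mat" where
  "local_op Alice M \<psi> = M * \<psi>"
| "local_op Bob M \<psi> = \<psi> * transpose_mat M"

lemma local_op_prod_state:
  assumes "M \<in> carrier_mat m m" "N \<in> carrier_mat n n" "u \<in> carrier_vec m" "v \<in> carrier_vec n"
  shows "local_op Alice M (prod_state u v) = prod_state (M *\<^sub>v u) v"
    and "local_op Bob N (prod_state u v) = prod_state u (N *\<^sub>v v)"
  using assms
  by (auto intro!: eq_matI simp: prod_state_def scalar_prod_def sum_distrib_left sum_distrib_right
      mult_ac)

text \<open>The unnormalised state after observing a complete sequence of outcomes.\<close>

fun post_state :: "protocol \<Rightarrow> nat list \<Rightarrow> complex mat \<Rightarrow> complex mat" where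
  "post_state (Measure p bs) (x # xs) \<psi> =
     post_state (snd (bs ! x)) xs (local_op p (fst (bs ! x)) \<psi>)"
| "post_state _ _ \<psi> = \<psi>"

definition outcome_prob :: "protocol \<Rightarrow> nat list \<Rightarrow> complex mat \<Rightarrow> real" where
  "outcome_prob P xs \<psi> =
     Re (state_inner (post_state P xs \<psi>) (post_state P xs \<psi>)) / Re (state_inner \<psi> \<psi>)"

text \<open>Here \<open>S\<close> is a set of states of \<open>\<complex>\<^sup>m \<otimes> \<complex>\<^sup>n\<close> and \<open>\<Psi>\<close> is the shared resource.\<close>

definition locc_distinguishable_with ::
    "complex mat \<Rightarrow> nat \<Rightarrow> nat \<Rightarrow> complex mat set \<Rightarrow> bool" where
  "locc_distinguishable_with \<Psi> m n S \<longleftrightarrow>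
     (\<exists>P. locc_protocol (dim_row \<Psi> * m) (dim_col \<Psi> * n) P \<and>
        (\<forall>xs. complete_outcomes P xs \<longrightarrow>
           (\<forall>\<phi>\<in>S. \<forall>\<chi>\<in>S.
              outcome_prob P xs (joint_state \<Psi> \<phi>) \<noteq> 0 \<longrightarrow>
              outcome_prob P xs (joint_state \<Psi> \<chi>) \<noteq> 0 \<longrightarrow> \<phi> = \<chi>)))"


section \<open>The set of product states\<close>

definition omega :: "nat \<Rightarrow> nat \<Rightarrow> complex" where
  "omega d t = exp (2 * complex_of_real pi * \<i> / of_nat (d - 1 - 2 * t))"

text \<open>The vector \<open>\<Sum>\<^sub>j \<omega>\<^sub>t\<^sup>j\<^sup>k |j\<rangle>\<close> of \<open>\<complex>\<^sup>d\<close>, with \<open>j\<close> running over \<open>{l..h}\<close>.\<close>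

definition phase_vec :: "nat \<Rightarrow> nat \<Rightarrow> nat \<Rightarrow> nat \<Rightarrow> nat \<Rightarrow> complex vec" where
  "phase_vec d t k l h = vec d (\<lambda>j. if j \<in> {l..h} then omega d t ^ (j * k) else 0)"

definition stopper :: "nat \<Rightarrow> complex mat" where
  "stopper d = prod_state (vec d (\<lambda>j. 1)) (vec d (\<lambda>j. 1))"

definition tile_states :: "nat \<Rightarrow> nat \<Rightarrow> nat \<Rightarrow> complex mat set" where
  "tile_states d t k =
     {prod_state (unit_vec d t) (phase_vec d t k t (d - 2 - t)),
      prod_state (phase_vec d t k t (d - 2 - t)) (unit_vec d (d - 1 - t)),
      prod_state (unit_vec d (d - 1 - t)) (phase_vec d t k (t + 1) (d - 1 - t)),
      prod_state (phase_vec d t k (t + 1) (d - 1 - t)) (unit_vec d t)}"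

definition U_states :: "nat \<Rightarrow> complex mat set" where
  "U_states d =
     (\<Union>t\<in>{0..(d - 3) div 2}. \<Union>k\<in>{1..d - 2 - 2 * t}. tile_states d t k) \<union> {stopper d}"

end

theory Submission
  imports Defs
begin

text \<open>
  Bob first correlates his half of the \<open>2\<^sup>r\<close>-dimensional ancilla with a label of his basis index \<open>j\<close>
  that singles out each column \<open>j > r\<close> (here \<open>d = 2 r + 1\<close>); the \<open>r + 1 \<le> 2\<^sup>r\<close> labels needed fit
  into \<open>r\<close> ebits.  Afterwards Alice can make projections depending on both her index \<open>i\<close> and the
  label of \<open>j\<close>, and Bob on \<open>j\<close>.  In this way the tiles are cut off one by one, layer by layer from the
  outside, until only the central cell is left.  On a tile every state restricts to \<open>0\<close> or to
  a phase vector, the stopper being the phase \<open>k = 0\<close>, so the nonzero restrictions are orthogonal.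
  On a horizontal tile Alice, whose ancilla is still entangled with Bob's index, measures in the
  Fourier basis, which leaves Bob with orthogonal vectors.
\<close>

section \<open>Separating a family of states\<close>

text \<open>The family is indexed because distinct members may become equal after a measurement,
  notably both zero. Non-vanishing of the final state stands for nonzero probability.\<close>

definition locc_separates :: "nat \<Rightarrow> nat \<Rightarrow> 'i set \<Rightarrow> ('i \<Rightarrow> complex mat) \<Rightarrow> bool" where
  "locc_separates m n I \<psi> \<longleftrightarrow>
     (\<exists>P. locc_protocol m n P \<and>
        (\<forall>xs. complete_outcomes P xs \<longrightarrow>
           (\<forall>i\<in>I. \<forall>j\<in>I. post_state P xs (\<psi> i) \<noteq> 0\<^sub>m m n \<longrightarrow> post_state P xs (\<psi> j) \<noteq> 0\<^sub>m m n \<longrightarrow> i = j)))"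

lemma locc_separates_Done:
  assumes "\<And>i j. i \<in> I \<Longrightarrow> j \<in> I \<Longrightarrow> \<psi> i \<noteq> 0\<^sub>m m n \<Longrightarrow> \<psi> j \<noteq> 0\<^sub>m m n \<Longrightarrow> i = j"
  shows "locc_separates m n I \<psi>"
  unfolding locc_separates_def using assms by (intro exI[of _ Done]) auto

lemma locc_separates_cong:
  assumes "\<And>i. i \<in> I \<Longrightarrow> \<psi> i = \<psi>' i"
  shows "locc_separates m n I \<psi> \<longleftrightarrow> locc_separates m n I \<psi>'"
  unfolding locc_separates_def using assms by simp

text \<open>Protocols are trees, so each outcome of a first measurement can be continued by whatever
  protocol separates the resulting family.\<close>

lemma locc_separates_Alice:
  assumes "measurement m Ms" and sep: "\<And>M. M \<in> set Ms \<Longrightarrow> locc_separates m n I (\<lambda>i. M * \<psi> i)"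
  shows "locc_separates m n I \<psi>"
proof -
  define good where "good M P \<longleftrightarrow> locc_protocol m n P \<and>
        (\<forall>xs. complete_outcomes P xs \<longrightarrow>
           (\<forall>i\<in>I. \<forall>j\<in>I. post_state P xs (M * \<psi> i) \<noteq> 0\<^sub>m m n \<longrightarrow>
              post_state P xs (M * \<psi> j) \<noteq> 0\<^sub>m m n \<longrightarrow> i = j))" for M P
  have "\<forall>M\<in>set Ms. \<exists>P. good M P"
    using sep unfolding locc_separates_def good_def by blast
  then obtain Q where Q: "\<And>M. M \<in> set Ms \<Longrightarrow> good M (Q M)"
    by metis
  let ?P = "Measure Alice (map (\<lambda>M. (M, Q M)) Ms)"
  have "locc_protocol m n ?P"
    using assms(1) Q by (auto simp: good_def comp_def)
  moreover have "i = j" if "complete_outcomes ?P xs" "i \<in> I" "j \<in> I"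
    "post_state ?P xs (\<psi> i) \<noteq> 0\<^sub>m m n" "post_state ?P xs (\<psi> j) \<noteq> 0\<^sub>m m n" for xs i j
  proof (cases xs)
    case Nil
    then show ?thesis using that(1) by simp
  next
    case (Cons x ys)
    then have "x < length Ms" "complete_outcomes (Q (Ms ! x)) ys"
      using that(1) by auto
    then show ?thesis
      using Q[of "Ms ! x"] that(2-5) Cons by (auto simp: good_def)
  qed
  ultimately show ?thesis
    unfolding locc_separates_def by (intro exI[of _ ?P]) blast
qed

section \<open>Exchanging the two parties\<close>

primrec swap_parties :: "protocol \<Rightarrow> protocol" where
  "swap_parties Done = Done"
| "swap_parties (Measure p bs) =
     Measure (case p of Alice \<Rightarrow> Bob | Bob \<Rightarrow> Alice) (map (map_prod id swap_parties) bs)"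

lemma locc_protocol_swap_parties:
  "locc_protocol n m P \<Longrightarrow> locc_protocol m n (swap_parties P)"
proof (induction P)
  case (Measure p bs)
  show ?case
  proof (cases p)
    case Alice
    then show ?thesis using Measure by (fastforce simp: comp_def)
  next
    case Bob
    then show ?thesis using Measure by (fastforce simp: comp_def)
  qed
qed simp

lemma complete_outcomes_swap_parties:
  "complete_outcomes (swap_parties P) xs \<longleftrightarrow> complete_outcomes P xs"
proof (induction P arbitrary: xs)
  case (Measure p bs)
  show ?case
  proof (cases xs)
    case (Cons x ys)
    have "complete_outcomes (swap_parties (snd (bs ! x))) ys \<longleftrightarrow> complete_outcomes (snd (bs ! x)) ys"
      if "x < length bs"
      by (rule Measure[of "bs ! x"]) (use that in \<open>auto simp: snds.simps\<close>)
    then show ?thesis using Cons by auto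
  qed simp
qed simp

text \<open>Transposition reverses products, so it turns an operation of one party into the same
  operation of the other; this is iterated along the branch \<open>xs\<close>. Validity of
  \<open>P\<close> and completeness of \<open>xs\<close> keep the dimensions matching.\<close>

lemma post_state_swap_parties:
  assumes "locc_protocol n m P" "complete_outcomes P xs" "\<phi> \<in> carrier_mat m n"
  shows "post_state (swap_parties P) xs \<phi> = transpose_mat (post_state P xs (transpose_mat \<phi>))"
  using assms
proof (induction P arbitrary: xs \<phi>)
  case (Measure p bs)
  from Measure.prems(2) obtain x ys where xs: "xs = x # ys" "x < length bs"
      "complete_outcomes (snd (bs ! x)) ys"
    by (cases xs) auto
  have bx: "bs ! x \<in> set bs" using xs by simp
  define M where "M = fst (bs ! x)"
  define q where "q = (case p of Alice \<Rightarrow> Bob | Bob \<Rightarrow> Alice)"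
  have M: "M \<in> carrier_mat (case p of Alice \<Rightarrow> n | Bob \<Rightarrow> m) (case p of Alice \<Rightarrow> n | Bob \<Rightarrow> m)"
    using Measure.prems(1) bx unfolding M_def measurement_def
    by (cases p) (force simp: measurement_def)+
  have carr: "local_op q M \<phi> \<in> carrier_mat m n"
    using M Measure.prems(3) by (cases p) (auto simp: q_def)
  have tr: "transpose_mat (local_op q M \<phi>) = local_op p M (transpose_mat \<phi>)"
  proof (cases p)
    case Alice
    then show ?thesis using M Measure.prems(3)
      by (simp add: q_def transpose_mult[of \<phi> m n "transpose_mat M" n])
  next
    case Bob
    then show ?thesis using M Measure.prems(3)
      by (simp add: q_def transpose_mult[of M m m \<phi> n])
  qed
  have "post_state (swap_parties (snd (bs ! x))) ys (local_op q M \<phi>) =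
      transpose_mat (post_state (snd (bs ! x)) ys (transpose_mat (local_op q M \<phi>)))"
    by (rule Measure.IH[of "bs ! x"])
      (use bx xs Measure.prems(1) carr in \<open>auto simp: snds.simps\<close>)
  then show ?case
    unfolding tr using xs by (simp add: M_def q_def)
qed simp

text \<open>Symmetry principle: whatever is proved with Alice measuring carries over to Bob through
  the transposed family.\<close>

lemma locc_separates_transpose:
  assumes "\<And>i. i \<in> I \<Longrightarrow> \<psi> i \<in> carrier_mat m n"
    and "locc_separates n m I (\<lambda>i. transpose_mat (\<psi> i))"
  shows "locc_separates m n I \<psi>"
proof -
  from assms(2) obtain P where P: "locc_protocol n m P"
    "\<And>xs i j. complete_outcomes P xs \<Longrightarrow> i \<in> I \<Longrightarrow> j \<in> I \<Longrightarrow>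
       post_state P xs (transpose_mat (\<psi> i)) \<noteq> 0\<^sub>m n m \<Longrightarrow>
       post_state P xs (transpose_mat (\<psi> j)) \<noteq> 0\<^sub>m n m \<Longrightarrow> i = j"
    unfolding locc_separates_def by blast
  show ?thesis
    unfolding locc_separates_def
  proof (intro exI[of _ "swap_parties P"] conjI allI impI ballI)
    show "locc_protocol m n (swap_parties P)"
      by (rule locc_protocol_swap_parties[OF P(1)])
    fix xs i j
    assume *: "complete_outcomes (swap_parties P) xs" "i \<in> I" "j \<in> I"
      "post_state (swap_parties P) xs (\<psi> i) \<noteq> 0\<^sub>m m n"
      "post_state (swap_parties P) xs (\<psi> j) \<noteq> 0\<^sub>m m n"
    have c: "complete_outcomes P xs"
      using *(1) by (simp add: complete_outcomes_swap_parties)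
    have "post_state P xs (transpose_mat (\<psi> k)) \<noteq> 0\<^sub>m n m"
      if "k \<in> I" "post_state (swap_parties P) xs (\<psi> k) \<noteq> 0\<^sub>m m n" for k
      using that post_state_swap_parties[OF P(1) c assms(1)[OF that(1)]] by auto
    then show "i = j" using P(2)[OF c] * by blast
  qed
qed

section \<open>Measurements\<close>

lemma foldr_add_mat:
  assumes "\<And>A. A \<in> set As \<Longrightarrow> A \<in> carrier_mat n n"
  shows "foldr (+) As (0\<^sub>m n n) \<in> carrier_mat n n"
    and "i < n \<Longrightarrow> j < n \<Longrightarrow> foldr (+) As (0\<^sub>m n n) $$ (i, j) = (\<Sum>A\<leftarrow>As. A $$ (i, j))"
  using assms by (induction As) auto

lemma adjoint_mult_index:
  assumes "M \<in> carrier_mat n n" "i < n" "j < n"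
  shows "(mat_adjoint M * M) $$ (i, j) = (\<Sum>k<n. cnj (M $$ (k, i)) * M $$ (k, j))"
  using assms unfolding mat_adjoint_def
  by (auto simp: scalar_prod_def conjugate_complex_def atLeast0LessThan intro!: sum.cong)

lemma measurementI:
  assumes M: "\<And>M. M \<in> set Ms \<Longrightarrow> M \<in> carrier_mat n n"
    and sum: "\<And>i j. i < n \<Longrightarrow> j < n \<Longrightarrow>
      (\<Sum>M\<leftarrow>Ms. \<Sum>k<n. cnj (M $$ (k, i)) * M $$ (k, j)) = (if i = j then 1 else 0)"
  shows "measurement n Ms"
proof -
  have adj: "mat_adjoint M * M \<in> carrier_mat n n" if "M \<in> set Ms" for M
    using M[OF that] unfolding mat_adjoint_def by (auto intro!: mult_carrier_mat)
  have c: "\<And>A. A \<in> set (map (\<lambda>M. mat_adjoint M * M) Ms) \<Longrightarrow> A \<in> carrier_mat n n"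
    using adj by auto
  have "foldr (+) (map (\<lambda>M. mat_adjoint M * M) Ms) (0\<^sub>m n n) = 1\<^sub>m n"
  proof (rule eq_matI)
    fix i j assume "i < dim_row (1\<^sub>m n :: complex mat)" "j < dim_col (1\<^sub>m n :: complex mat)"
    then have ij: "i < n" "j < n" by auto
    have "foldr (+) (map (\<lambda>M. mat_adjoint M * M) Ms) (0\<^sub>m n n) $$ (i, j) =
        (\<Sum>M\<leftarrow>Ms. (mat_adjoint M * M) $$ (i, j))"
      using foldr_add_mat(2)[of "map (\<lambda>M. mat_adjoint M * M) Ms", OF c ij] by (simp add: comp_def)
    also have "\<dots> = (\<Sum>M\<leftarrow>Ms. \<Sum>k<n. cnj (M $$ (k, i)) * M $$ (k, j))"
      by (intro arg_cong[where f = sum_list] map_cong refl adjoint_mult_index M ij)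
    finally show "foldr (+) (map (\<lambda>M. mat_adjoint M * M) Ms) (0\<^sub>m n n) $$ (i, j) = 1\<^sub>m n $$ (i, j)"
      using sum[OF ij] ij by simp
  qed (use foldr_add_mat(1)[of "map (\<lambda>M. mat_adjoint M * M) Ms", OF c] in auto)
  then show ?thesis
    using M unfolding measurement_def by blast
qed

section \<open>Measurements in the standard basis\<close>

definition proj_mat :: "nat \<Rightarrow> (nat \<Rightarrow> bool) \<Rightarrow> complex mat" where
  "proj_mat m Z = mat m m (\<lambda>(i, j). if i = j \<and> Z i then 1 else 0)"

definition restrict_mat :: "(nat \<Rightarrow> nat \<Rightarrow> bool) \<Rightarrow> complex mat \<Rightarrow> complex mat" where
  "restrict_mat R \<psi> = mat (dim_row \<psi>) (dim_col \<psi>) (\<lambda>(x, y). if R x y then \<psi> $$ (x, y) else 0)"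

lemma proj_mat_mult:
  assumes "\<psi> \<in> carrier_mat m n"
  shows "proj_mat m Z * \<psi> = restrict_mat (\<lambda>x y. Z x) \<psi>"
proof (rule eq_matI)
  fix x y assume "x < dim_row (restrict_mat (\<lambda>x y. Z x) \<psi>)" "y < dim_col (restrict_mat (\<lambda>x y. Z x) \<psi>)"
  then have xy: "x < m" "y < n" using assms by (auto simp: restrict_mat_def)
  have "(proj_mat m Z * \<psi>) $$ (x, y) = (\<Sum>k<m. (if x = k then (if Z x then \<psi> $$ (k, y) else 0) else 0))"
    using xy assms
    unfolding proj_mat_def
    by (auto simp: scalar_prod_def atLeast0LessThan simp del: sum.delta sum.delta' intro!: sum.cong)
  also have "\<dots> = (if Z x then \<psi> $$ (x, y) else 0)"
    using xy by simp
  finally show "(proj_mat m Z * \<psi>) $$ (x, y) = restrict_mat (\<lambda>x y. Z x) \<psi> $$ (x, y)"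
    using xy assms by (simp add: restrict_mat_def)
qed (use assms in \<open>auto simp: restrict_mat_def proj_mat_def\<close>)

text \<open>The level sets of \<open>f\<close> partition the basis, so the coordinate projections
  onto them add up to the identity.\<close>

lemma measurement_proj_mat:
  assumes "\<And>i. i < m \<Longrightarrow> f i < k"
  shows "measurement m (map (\<lambda>s. proj_mat m (\<lambda>i. f i = s)) [0..<k])"
proof (rule measurementI)
  fix i j assume ij: "i < m" "j < m"
  have "(\<Sum>M\<leftarrow>map (\<lambda>s. proj_mat m (\<lambda>i. f i = s)) [0..<k]. \<Sum>l<m. cnj (M $$ (l, i)) * M $$ (l, j)) =
      (\<Sum>s<k. \<Sum>l<m. cnj (proj_mat m (\<lambda>i. f i = s) $$ (l, i)) * proj_mat m (\<lambda>i. f i = s) $$ (l, j))"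
    by (simp add: comp_def sum_list_distinct_conv_sum_set atLeast0LessThan)
  also have "\<dots> = (\<Sum>s<k. \<Sum>l<m. if l = i then (if i = j \<and> s = f i then 1 else 0) else 0)"
    using ij by (intro sum.cong) (auto simp: proj_mat_def)
  also have "\<dots> = (\<Sum>s<k. if s = f i then (if i = j then 1 else 0) else 0)"
    using ij by (intro sum.cong) auto
  also have "\<dots> = (if i = j then 1 else 0)"
    using ij assms by simp
  finally show "(\<Sum>M\<leftarrow>map (\<lambda>s. proj_mat m (\<lambda>i. f i = s)) [0..<k]. \<Sum>l<m. cnj (M $$ (l, i)) * M $$ (l, j)) =
    (if i = j then 1 else 0)" .
qed (auto simp: proj_mat_def)

lemma locc_separates_rows:
  assumes \<psi>: "\<And>i. i \<in> I \<Longrightarrow> \<psi> i \<in> carrier_mat m n"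
    and f: "\<And>x. x < m \<Longrightarrow> f x < (k :: nat)"
    and sep: "\<And>s. s < k \<Longrightarrow> locc_separates m n I (\<lambda>i. restrict_mat (\<lambda>x y. f x = s) (\<psi> i))"
  shows "locc_separates m n I \<psi>"
proof (rule locc_separates_Alice[OF measurement_proj_mat[of m f k, OF f]])
  fix M assume "M \<in> set (map (\<lambda>s. proj_mat m (\<lambda>i. f i = s)) [0..<k])"
  then obtain s where s: "s < k" "M = proj_mat m (\<lambda>i. f i = s)" by auto
  show "locc_separates m n I (\<lambda>i. M * \<psi> i)"
    using sep[OF s(1)] proj_mat_mult[OF \<psi>]
    by (subst locc_separates_cong[of _ _ "\<lambda>i. restrict_mat (\<lambda>x y. f x = s) (\<psi> i)"])
      (auto simp: s(2))
qed auto

lemma locc_separates_columns: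
  assumes \<psi>: "\<And>i. i \<in> I \<Longrightarrow> \<psi> i \<in> carrier_mat m n"
    and f: "\<And>y. y < n \<Longrightarrow> f y < (k :: nat)"
    and sep: "\<And>s. s < k \<Longrightarrow> locc_separates m n I (\<lambda>i. restrict_mat (\<lambda>x y. f y = s) (\<psi> i))"
  shows "locc_separates m n I \<psi>"
proof (rule locc_separates_transpose[OF \<psi>], assumption,
    rule locc_separates_rows[of _ _ _ _ f k, OF _ f])
  fix s assume s: "s < k"
  show "locc_separates n m I (\<lambda>i. restrict_mat (\<lambda>x y. f x = s) (transpose_mat (\<psi> i)))"
  proof (rule locc_separates_transpose)
    have tr: "transpose_mat (restrict_mat (\<lambda>x y. f x = s) (transpose_mat (\<psi> i))) =
        restrict_mat (\<lambda>x y. f y = s) (\<psi> i)" for i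
      by (rule eq_matI) (auto simp: restrict_mat_def)
    show "locc_separates m n I
        (\<lambda>i. transpose_mat (restrict_mat (\<lambda>x y. f x = s) (transpose_mat (\<psi> i))))"
      unfolding tr by (rule sep[OF s])
  qed (use \<psi> in \<open>fastforce simp: restrict_mat_def\<close>)
qed (use \<psi> in auto)

section \<open>Separating orthogonal states supported on a line\<close>

lemma state_inner_carrier:
  assumes "\<phi> \<in> carrier_mat m n"
  shows "state_inner \<phi> \<psi> = (\<Sum>x<m. \<Sum>y<n. cnj (\<phi> $$ (x, y)) * \<psi> $$ (x, y))"
  using assms by (simp add: state_inner_def)

lemma state_inner_transpose:
  assumes "\<phi> \<in> carrier_mat m n" "\<psi> \<in> carrier_mat m n"
  shows "state_inner (transpose_mat \<phi>) (transpose_mat \<psi>) = state_inner \<phi> \<psi>"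
proof -
  have "state_inner (transpose_mat \<phi>) (transpose_mat \<psi>) =
      (\<Sum>y<n. \<Sum>x<m. cnj (\<phi> $$ (x, y)) * \<psi> $$ (x, y))"
    using assms by (subst state_inner_carrier[of _ n m]) auto
  also have "\<dots> = state_inner \<phi> \<psi>"
    using assms by (subst sum.swap) (simp add: state_inner_carrier)
  finally show ?thesis .
qed

text \<open>\<open>p\<close> is the orthogonal projection onto the line of \<open>v\<close>, with
  \<open>N\<close> the squared norm of \<open>v\<close>. Being Hermitian and idempotent, it and its
  complement satisfy the completeness relation.\<close>

lemma rank_one_measurement:
  fixes m :: nat and v :: "nat \<Rightarrow> complex"
  defines "N \<equiv> (\<Sum>k<m. cnj (v k) * v k)"
  defines "p \<equiv> (\<lambda>x y. v x * cnj (v y) / N)"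
  assumes "N \<noteq> 0"
  shows "measurement m [mat m m (\<lambda>(x, y). p x y), mat m m (\<lambda>(x, y). (if x = y then 1 else 0) - p x y)]"
proof (rule measurementI)
  have herm: "cnj (p y x) = p x y" for x y
    by (simp add: p_def N_def mult_ac)
  have idem: "(\<Sum>k<m. cnj (p k i) * p k j) = p i j" for i j
  proof -
    have "(\<Sum>k<m. cnj (p k i) * p k j) = (\<Sum>k<m. (v i * cnj (v j) / N / N) * (cnj (v k) * v k))"
      by (intro sum.cong refl, subst herm) (simp add: p_def)
    also have "\<dots> = (v i * cnj (v j) / N / N) * N"
      unfolding N_def sum_distrib_left ..
    finally show ?thesis using assms(3) by (simp add: p_def)
  qed
  fix i j assume ij: "i < m" "j < m"
  have "(\<Sum>k<m. cnj ((if k = i then 1 else 0) - p k i) * ((if k = j then 1 else 0) - p k j)) =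
      (\<Sum>k<m. (if k = i then (if i = j then 1 else 0) - p k j else 0) -
         (if k = j then cnj (p k i) else 0) + cnj (p k i) * p k j)"
    by (intro sum.cong) (auto simp: algebra_simps)
  also have "\<dots> = (if i = j then 1 else 0) - p i j - cnj (p j i) + p i j"
    using ij by (simp add: sum.distrib sum_subtractf idem)
  also have "\<dots> = (if i = j then 1 else 0) - p i j"
    by (simp add: herm)
  finally show "(\<Sum>M\<leftarrow>[mat m m (\<lambda>(x, y). p x y), mat m m (\<lambda>(x, y). (if x = y then 1 else 0) - p x y)].
      \<Sum>k<m. cnj (M $$ (k, i)) * M $$ (k, j)) = (if i = j then 1 else 0)"
    using ij idem by simp
qed auto

text \<open>Bob is in the fixed basis vector \<open>c\<close> and Alice's vectors are orthogonal, so
  Alice alone can test for one nonzero member after the other.\<close>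

lemma locc_separates_one_column:
  assumes "finite I"
    and "\<And>i. i \<in> I \<Longrightarrow> \<psi> i \<in> carrier_mat m n"
    and "\<And>i x y. i \<in> I \<Longrightarrow> x < m \<Longrightarrow> y < n \<Longrightarrow> y \<noteq> c \<Longrightarrow> \<psi> i $$ (x, y) = 0"
    and "\<And>i j. i \<in> I \<Longrightarrow> j \<in> I \<Longrightarrow> i \<noteq> j \<Longrightarrow> state_inner (\<psi> i) (\<psi> j) = 0"
  shows "locc_separates m n I \<psi>"
  using assms(2-4)
\<comment> \<open>The measure counts the nonzero members; each failed test removes one.\<close>
proof (induction "card {i \<in> I. \<psi> i \<noteq> 0\<^sub>m m n}" arbitrary: \<psi> rule: less_induct)
  case (less \<psi>)
  show ?case
  proof (cases "\<forall>i\<in>I. \<psi> i = 0\<^sub>m m n")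
    case True
    then show ?thesis by (intro locc_separates_Done) auto
  next
    case False
    then obtain i where i: "i \<in> I" "\<psi> i \<noteq> 0\<^sub>m m n" by blast
    obtain x0 y0 where xy0: "x0 < m" "y0 < n" "\<psi> i $$ (x0, y0) \<noteq> 0"
      using i less.prems(1)[of i] by (metis carrier_matD eq_matI index_zero_mat)
    then have y0: "y0 = c" using less.prems(2) i(1) by blast
    with xy0 have c: "c < n" by simp
    define v where "v x = \<psi> i $$ (x, c)" for x
    define N where "N = (\<Sum>k<m. cnj (v k) * v k)"
    define p where "p x y = v x * cnj (v y) / N" for x y
    have "N = complex_of_real (\<Sum>k<m. (cmod (v k))\<^sup>2)"
      unfolding N_def of_real_sum by (intro sum.cong refl) (metis complex_norm_square mult.commute)
    moreover have "(\<Sum>k<m. (cmod (v k))\<^sup>2) > 0"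
      using xy0 y0 by (intro sum_pos2[of _ x0]) (auto simp: v_def)
    ultimately have N: "N \<noteq> 0"
      by (metis less_irrefl of_real_eq_0_iff)
    have inner: "(\<Sum>k<m. cnj (v k) * \<psi> j $$ (k, c)) = state_inner (\<psi> i) (\<psi> j)" if "j \<in> I" for j
    proof -
      have "state_inner (\<psi> i) (\<psi> j) =
          (\<Sum>k<m. \<Sum>y<n. if y = c then cnj (v k) * \<psi> j $$ (k, c) else 0)"
        unfolding state_inner_carrier[OF less.prems(1)[OF i(1)]]
        using less.prems(2)[OF i(1)] by (intro sum.cong) (auto simp: v_def)
      also have "\<dots> = (\<Sum>k<m. cnj (v k) * \<psi> j $$ (k, c))"
        using c by simp
      finally show ?thesis ..
    qed
    \<comment> \<open>By orthogonality the projection onto member \<open>i\<close> fixes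
      \<open>\<psi> i\<close> and annihilates all other members; columns other than \<open>c\<close>
      are zero already.\<close>
    have p_mult: "(\<Sum>k<m. p x k * \<psi> j $$ (k, y)) = (if j = i then \<psi> i $$ (x, y) else 0)"
      if "j \<in> I" "x < m" "y < n" for j x y
    proof (cases "y = c")
      case True
      have "(\<Sum>k<m. p x k * \<psi> j $$ (k, y)) = v x / N * (\<Sum>k<m. cnj (v k) * \<psi> j $$ (k, c))"
        by (simp add: p_def True sum_distrib_left mult.assoc)
      also have "\<dots> = (if j = i then v x else 0)"
        using inner[OF that(1)] inner[OF i(1)] less.prems(3)[OF i(1) that(1)] N
        by (auto simp: N_def v_def)
      finally show ?thesis using True by (simp add: v_def)
    next
      case False
      then show ?thesis using less.prems(2) that i(1) by simp
    qed
    let ?P = "mat m m (\<lambda>(x, y). p x y)"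
    let ?Q = "mat m m (\<lambda>(x, y). (if x = y then 1 else 0) - p x y)"
    have P: "?P * \<psi> j = (if j = i then \<psi> i else 0\<^sub>m m n)" if "j \<in> I" for j
      using less.prems(1)[OF that] less.prems(1)[OF i(1)] p_mult[OF that]
      by (intro eq_matI) (auto simp: scalar_prod_def atLeast0LessThan)
    have Q: "?Q * \<psi> j = (if j = i then 0\<^sub>m m n else \<psi> j)" if j: "j \<in> I" for j
    proof (rule eq_matI)
      fix x y
      assume "x < dim_row (if j = i then 0\<^sub>m m n else \<psi> j)" "y < dim_col (if j = i then 0\<^sub>m m n else \<psi> j)"
      then have xy: "x < m" "y < n" using less.prems(1)[OF j] by (auto split: if_splits)
      have "(?Q * \<psi> j) $$ (x, y) = (\<Sum>k<m. ((if x = k then 1 else 0) - p x k) * \<psi> j $$ (k, y))"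
        using xy less.prems(1)[OF j] by (simp add: scalar_prod_def atLeast0LessThan)
      also have "\<dots> = (\<Sum>k<m. (if k = x then \<psi> j $$ (k, y) else 0) - p x k * \<psi> j $$ (k, y))"
        by (intro sum.cong) (auto simp: algebra_simps)
      also have "\<dots> = \<psi> j $$ (x, y) - (if j = i then \<psi> i $$ (x, y) else 0)"
        using xy by (simp add: sum_subtractf p_mult[OF j xy])
      finally show "(?Q * \<psi> j) $$ (x, y) = (if j = i then 0\<^sub>m m n else \<psi> j) $$ (x, y)"
        using xy by simp
    qed (use less.prems(1)[OF j] in auto)
    \<comment> \<open>A positive test leaves only member \<open>i\<close>; a negative one erases it
      and leaves the others undisturbed, so the induction hypothesis applies.\<close>
    have "locc_separates m n I (\<lambda>j. ?P * \<psi> j)"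
      by (rule locc_separates_Done) (auto simp: P split: if_splits)
    moreover have "locc_separates m n I (\<lambda>j. if j = i then 0\<^sub>m m n else \<psi> j)" (is "locc_separates m n I ?\<psi>'")
    proof (rule less.hyps)
      show "card {j \<in> I. ?\<psi>' j \<noteq> 0\<^sub>m m n} < card {j \<in> I. \<psi> j \<noteq> 0\<^sub>m m n}"
        using assms(1) i by (intro psubset_card_mono) auto
      show "state_inner (?\<psi>' j) (?\<psi>' k) = 0" if "j \<in> I" "k \<in> I" "j \<noteq> k" for j k
        using that less.prems(1)[of j] less.prems(1)[of k] less.prems(3)[of j k]
        by (auto simp: state_inner_def)
    qed (use less.prems in auto)
    then have "locc_separates m n I (\<lambda>j. ?Q * \<psi> j)"
      by (subst locc_separates_cong[OF Q])
    moreover have "measurement m [?P, ?Q]"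
      unfolding p_def N_def by (rule rank_one_measurement[where v = v, OF N[unfolded N_def]])
    ultimately show ?thesis
      by - (rule locc_separates_Alice[of m "[?P, ?Q]"], auto simp del: index_mat)
  qed
qed

lemma locc_separates_one_row:
  assumes "finite I"
    and \<psi>: "\<And>i. i \<in> I \<Longrightarrow> \<psi> i \<in> carrier_mat m n"
    and supp: "\<And>i x y. i \<in> I \<Longrightarrow> x < m \<Longrightarrow> y < n \<Longrightarrow> x \<noteq> r \<Longrightarrow> \<psi> i $$ (x, y) = 0"
    and orth: "\<And>i j. i \<in> I \<Longrightarrow> j \<in> I \<Longrightarrow> i \<noteq> j \<Longrightarrow> state_inner (\<psi> i) (\<psi> j) = 0"
  shows "locc_separates m n I \<psi>"
proof (rule locc_separates_transpose[OF \<psi>], assumption, rule locc_separates_one_column[OF assms(1)])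
  show "transpose_mat (\<psi> i) $$ (y, x) = 0" if "i \<in> I" "y < n" "x < m" "x \<noteq> r" for i x y
    using that \<psi>[of i] supp[of i x y] by auto
  show "state_inner (transpose_mat (\<psi> i)) (transpose_mat (\<psi> j)) = 0" if "i \<in> I" "j \<in> I" "i \<noteq> j" for i j
    using that by (simp add: state_inner_transpose[OF \<psi> \<psi>] orth)
qed (use \<psi> in auto)

section \<open>Fourier orthogonality and the Fourier measurement\<close>

lemma cnj_cis_power_mult:
  "cnj (cis t ^ a) * cis t ^ b = cis (t * (real b - real a))"
  by (simp add: Complex.DeMoivre cis_cnj cis_mult algebra_simps)

text \<open>The terms are powers of \<open>z\<close>, the root of unity with exponent
  \<open>b - a\<close>, so this is a geometric sum with \<open>z ^ n = 1\<close>;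
  \<open>z = 1\<close> only for \<open>a = b\<close>, as the n-th roots are distinct. The offset
  \<open>l\<close> contributes a factor \<open>z ^ l\<close> and serves tiles whose coordinates do
  not start at 0.\<close>

lemma sum_roots_of_unity:
  assumes "n > 0" "a < n" "b < n"
  defines "\<zeta> \<equiv> cis (2 * pi / real n)"
  shows "(\<Sum>s<n. cnj (\<zeta> ^ ((l + s) * a)) * \<zeta> ^ ((l + s) * b)) = (if a = b then of_nat n else 0)"
proof -
  define z where "z = cnj (\<zeta> ^ a) * \<zeta> ^ b"
  have \<zeta>n: "\<zeta> ^ n = 1"
    using assms(1) by (simp add: \<zeta>_def Complex.DeMoivre)
  have unit: "cnj \<zeta> * \<zeta> = 1"
    by (simp add: \<zeta>_def cis_cnj cis_mult)
  have z_pow: "cnj (\<zeta> ^ (k * a)) * \<zeta> ^ (k * b) = z ^ k" for k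
    by (simp only: z_def power_mult_distrib mult.commute[of k] power_mult complex_cnj_power)
  have sum: "(\<Sum>s<n. cnj (\<zeta> ^ ((l + s) * a)) * \<zeta> ^ ((l + s) * b)) = z ^ l * (\<Sum>s<n. z ^ s)"
    unfolding z_pow sum_distrib_left by (simp add: power_add)
  show ?thesis
  proof (cases "a = b")
    case True
    have "z = (cnj \<zeta> * \<zeta>) ^ b" using True by (simp add: z_def power_mult_distrib)
    then have "z = 1" using unit by simp
    then show ?thesis using True sum by simp
  next
    case False
    have "z \<noteq> 1"
    proof
      assume "z = 1"
      then have z1: "cnj (\<zeta> ^ a) * \<zeta> ^ b = 1" by (simp only: z_def)
      \<comment> \<open>\<open>cnj \<zeta>\<close> is the inverse of \<open>\<zeta>\<close>;
        inserting \<open>1\<close> in this form avoids negative exponents.\<close>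
      have "\<zeta> ^ b = (cnj \<zeta> * \<zeta>) ^ a * \<zeta> ^ b"
        by (simp only: unit power_one mult_1)
      also have "\<dots> = \<zeta> ^ a * (cnj (\<zeta> ^ a) * \<zeta> ^ b)"
        by (simp add: power_mult_distrib mult_ac)
      finally have "\<zeta> ^ b = \<zeta> ^ a"
        unfolding z1 by (simp only: mult_1_right)
      then have "cis (2 * pi * real b / real n) = cis (2 * pi * real a / real n)"
        by (simp add: \<zeta>_def Complex.DeMoivre mult.commute)
      then show False
        using inj_onD[OF bij_betw_imp_inj_on[OF bij_betw_roots_unity[OF assms(1)]], of b a] assms False
        by auto
    qed
    moreover have "z ^ n = 1"
      using \<zeta>n unfolding z_pow[symmetric] power_mult by simp
    ultimately show ?thesis
      using False sum by (simp add: geometric_sum)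
  qed
qed

lemma sum_single_support:
  fixes f :: "nat \<Rightarrow> complex"
  assumes "\<And>x. x < m \<Longrightarrow> x \<noteq> r \<Longrightarrow> f x = 0"
  shows "(\<Sum>x<m. f x) = (if r < m then f r else 0)"
proof -
  have "(\<Sum>x<m. f x) = (\<Sum>x<m. if x = r then f r else 0)"
    using assms by (intro sum.cong) auto
  then show ?thesis by simp
qed

text \<open>Alice's basis state \<open>\<rho> y\<close> is correlated with Bob's \<open>y\<close>.
  Her Fourier measurement replaces the correlation by a known phase on each column and scales all
  inner products alike, after which Bob can finish alone.\<close>

lemma locc_separates_one_row_per_column:
  assumes "finite I"
    and \<psi>: "\<And>i. i \<in> I \<Longrightarrow> \<psi> i \<in> carrier_mat m n"
    and supp: "\<And>i x y. i \<in> I \<Longrightarrow> x < m \<Longrightarrow> y < n \<Longrightarrow> x \<noteq> \<rho> y \<Longrightarrow> \<psi> i $$ (x, y) = 0"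
    and orth: "\<And>i j. i \<in> I \<Longrightarrow> j \<in> I \<Longrightarrow> i \<noteq> j \<Longrightarrow> state_inner (\<psi> i) (\<psi> j) = 0"
  shows "locc_separates m n I \<psi>"
proof -
  define \<zeta> where "\<zeta> = cis (2 * pi / real m)"
  \<comment> \<open>\<open>F s\<close> maps one Fourier basis vector to the basis vector 0 and
    annihilates the others, so afterwards only row 0 is occupied; \<open>sqrt m\<close> normalises
    the Fourier basis.\<close>
  define F where "F s = mat m m (\<lambda>(r, x). if r = 0 then \<zeta> ^ (s * x) / sqrt m else 0)" for s
  have cnj_\<zeta>: "cnj (\<zeta> ^ k) * \<zeta> ^ k = 1" for k
    unfolding \<zeta>_def cnj_cis_power_mult by simp
  have "measurement m (map F [0..<m])"
  proof (rule measurementI)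
    fix i j assume ij: "i < m" "j < m"
    then have m: "m > 0" by simp
    have sq: "complex_of_real (sqrt m) * complex_of_real (sqrt m) = of_nat m"
      by (simp flip: of_real_mult)
    have "(\<Sum>M\<leftarrow>map F [0..<m]. \<Sum>k<m. cnj (M $$ (k, i)) * M $$ (k, j)) =
        (\<Sum>s<m. \<Sum>k<m. cnj (F s $$ (k, i)) * F s $$ (k, j))"
      by (simp add: comp_def sum_list_distinct_conv_sum_set atLeast0LessThan)
    also have "\<dots> = (\<Sum>s<m. \<Sum>k<m. if k = 0 then cnj (\<zeta> ^ (s * i)) * \<zeta> ^ (s * j) / of_nat m else 0)"
      using ij sq by (intro sum.cong) (auto simp: F_def)
    also have "\<dots> = (\<Sum>s<m. cnj (\<zeta> ^ (s * i)) * \<zeta> ^ (s * j)) / of_nat m"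
      using m by (simp add: sum_divide_distrib)
    also have "\<dots> = (if i = j then 1 else 0)"
      using sum_roots_of_unity[OF m ij, of 0] m by (simp add: \<zeta>_def)
    finally show "(\<Sum>M\<leftarrow>map F [0..<m]. \<Sum>k<m. cnj (M $$ (k, i)) * M $$ (k, j)) = (if i = j then 1 else 0)" .
  qed (auto simp: F_def)
  moreover have "locc_separates m n I (\<lambda>i. M * \<psi> i)" if M: "M \<in> set (map F [0..<m])" for M
  proof -
    obtain s where s: "M = F s" "s < m" using M by auto
    \<comment> \<open>If \<open>\<rho> y\<close> is not a valid row, column \<open>y\<close>
      vanishes by \<open>supp\<close>; hence the guard.\<close>
    have M_index: "(M * \<psi> i) $$ (x, y) =
        (if x = 0 \<and> \<rho> y < m then \<zeta> ^ (s * \<rho> y) / sqrt m * \<psi> i $$ (\<rho> y, y) else 0)"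
      if i: "i \<in> I" and xy: "x < m" "y < n" for i x y
    proof -
      have "(M * \<psi> i) $$ (x, y) =
          (\<Sum>k<m. (if x = 0 then \<zeta> ^ (s * k) / sqrt m else 0) * \<psi> i $$ (k, y))"
        using xy \<psi>[OF i] by (simp add: s(1) F_def scalar_prod_def atLeast0LessThan)
      also have "\<dots> = (if \<rho> y < m then (if x = 0 then \<zeta> ^ (s * \<rho> y) / sqrt m else 0) * \<psi> i $$ (\<rho> y, y) else 0)"
        by (rule sum_single_support) (use supp[OF i] xy in auto)
      finally show ?thesis by simp
    qed
    have MC: "M * \<psi> i \<in> carrier_mat m n" if "i \<in> I" for i
      using \<psi>[OF that] by (auto simp: s(1) F_def)
    show ?thesis
    proof (rule locc_separates_one_row[OF assms(1) MC, where r = 0])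
      fix i j assume ij: "i \<in> I" "j \<in> I" "i \<noteq> j"
      have m0: "m > 0" using s(2) by simp
      have "state_inner (M * \<psi> i) (M * \<psi> j) =
          (\<Sum>x<m. if x = 0 then (\<Sum>y<n. cnj ((M * \<psi> i) $$ (0, y)) * (M * \<psi> j) $$ (0, y)) else 0)"
        unfolding state_inner_carrier[OF MC[OF ij(1)]]
        by (intro sum.cong refl) (auto simp: M_index ij)
      also have "\<dots> = (\<Sum>y<n. cnj ((M * \<psi> i) $$ (0, y)) * (M * \<psi> j) $$ (0, y))"
        using m0 by simp
      also have "\<dots> = (\<Sum>y<n. (\<Sum>x<m. cnj (\<psi> i $$ (x, y)) * \<psi> j $$ (x, y)) / of_nat m)"
      proof (intro sum.cong refl)
        fix y assume "y \<in> {..<n}"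
        then have y: "y < n" by simp
        have "(\<Sum>x<m. cnj (\<psi> i $$ (x, y)) * \<psi> j $$ (x, y)) =
            (if \<rho> y < m then cnj (\<psi> i $$ (\<rho> y, y)) * \<psi> j $$ (\<rho> y, y) else 0)"
          by (rule sum_single_support) (use supp[OF ij(1) _ y] in auto)
        \<comment> \<open>The phases have modulus one and cancel, leaving the common factor
          \<open>1 / m\<close>.\<close>
        moreover have "cnj (\<zeta> ^ k / sqrt m * a) * (\<zeta> ^ k / sqrt m * b) = cnj a * b / of_nat m" for k a b
        proof -
          have "cnj (\<zeta> ^ k / sqrt m * a) * (\<zeta> ^ k / sqrt m * b) =
              (cnj (\<zeta> ^ k) * \<zeta> ^ k) * (cnj a * b) / (complex_of_real (sqrt m) * complex_of_real (sqrt m))"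
            by (simp add: mult_ac)
          also have "complex_of_real (sqrt m) * complex_of_real (sqrt m) = of_nat m"
            by (simp flip: of_real_mult)
          finally show ?thesis by (simp only: cnj_\<zeta> mult_1)
        qed
        ultimately show "cnj ((M * \<psi> i) $$ (0, y)) * (M * \<psi> j) $$ (0, y) =
            (\<Sum>x<m. cnj (\<psi> i $$ (x, y)) * \<psi> j $$ (x, y)) / of_nat m"
          using M_index[OF ij(1) m0 y] M_index[OF ij(2) m0 y] by (cases "\<rho> y < m") (simp_all only: simp_thms if_True if_False complex_cnj_zero mult_zero_left div_0)
      qed
      also have "\<dots> = state_inner (\<psi> i) (\<psi> j) / of_nat m"
        unfolding state_inner_carrier[OF \<psi>[OF ij(1)]] by (subst sum.swap) (simp add: sum_divide_distrib)
      finally show "state_inner (M * \<psi> i) (M * \<psi> j) = 0"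
        using orth[OF ij] by simp
    qed (auto simp: M_index)
  qed
  ultimately show ?thesis by (rule locc_separates_Alice)
qed

section \<open>Protocols on the cells of the grid\<close>

text \<open>
  The state obtained from \<open>K\<close>-dimensional ancillas and \<open>\<phi>\<close> once both ancillas carry the label \<open>\<sigma> j\<close> of
  Bob's basis index \<open>j\<close> and only the cells \<open>(i, j) \<in> R\<close> are left.
\<close>

definition cell_state :: "nat \<Rightarrow> nat \<Rightarrow> (nat \<Rightarrow> nat) \<Rightarrow> (nat \<times> nat) set \<Rightarrow> complex mat \<Rightarrow> complex mat" where
  "cell_state K d \<sigma> R \<phi> = mat (K * d) (K * d) (\<lambda>(x, y).
     if x div d = \<sigma> (y mod d) \<and> y div d = \<sigma> (y mod d) \<and> (x mod d, y mod d) \<in> R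
     then \<phi> $$ (x mod d, y mod d) else 0)"

definition inner_on :: "(nat \<times> nat) set \<Rightarrow> complex mat \<Rightarrow> complex mat \<Rightarrow> complex" where
  "inner_on R \<phi> \<psi> = (\<Sum>p\<in>R. cnj (\<phi> $$ p) * \<psi> $$ p)"

lemma cell_state_carrier [simp]: "cell_state K d \<sigma> R \<phi> \<in> carrier_mat (K * d) (K * d)"
  by (simp add: cell_state_def)

text \<open>A cell \<open>(i, j)\<close> occupies the single entry \<open>?h (i, j)\<close> of the
  large matrix, and \<open>?h\<close> is injective: \<open>j\<close> is the column index modulo
  \<open>d\<close>, and then \<open>i\<close> follows by cancellation.\<close>

lemma state_inner_cell_state:
  assumes R: "R \<subseteq> {..<d} \<times> {..<d}" and \<sigma>: "\<And>j. j < d \<Longrightarrow> \<sigma> j < K"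
  shows "state_inner (cell_state K d \<sigma> R \<phi>) (cell_state K d \<sigma> R \<psi>) = inner_on R \<phi> \<psi>"
proof -
  let ?g = "\<lambda>(x, y). cnj (cell_state K d \<sigma> R \<phi> $$ (x, y)) * cell_state K d \<sigma> R \<psi> $$ (x, y)"
  let ?h = "\<lambda>(i, j). (\<sigma> j * d + i, \<sigma> j * d + j)"
  have bound: "a * d + i < K * d" if "a < K" "i < d" for a i
  proof -
    have "a * d + i < Suc a * d" using that by simp
    also have "\<dots> \<le> K * d" using that by (intro mult_le_mono1) simp
    finally show ?thesis .
  qed
  have inj: "inj_on ?h R"
  proof (rule inj_onI)
    fix p p' assume p: "p \<in> R" "p' \<in> R" and eq: "?h p = ?h p'"
    obtain i j i' j' where ij: "p = (i, j)" "p' = (i', j')" by fastforce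
    with p R have j: "j < d" "j' < d" by auto
    have eqs: "\<sigma> j * d + i = \<sigma> j' * d + i'" "\<sigma> j * d + j = \<sigma> j' * d + j'"
      using eq ij by auto
    have "j = (\<sigma> j * d + j) mod d" using j by simp
    also have "\<dots> = (\<sigma> j' * d + j') mod d" by (simp only: eqs)
    also have "\<dots> = j'" using j by simp
    finally have "j = j'" .
    with eqs(1) show "p = p'" using ij by simp
  qed
  have "state_inner (cell_state K d \<sigma> R \<phi>) (cell_state K d \<sigma> R \<psi>) =
      sum ?g ({..<K * d} \<times> {..<K * d})"
    by (simp add: state_inner_carrier[of _ "K * d" "K * d"] sum.cartesian_product)
  also have "\<dots> = sum ?g (?h ` R)"
  proof (rule sum.mono_neutral_right)
    show "?h ` R \<subseteq> {..<K * d} \<times> {..<K * d}"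
      using R \<sigma> by (auto intro!: bound)
    show "\<forall>p\<in>{..<K * d} \<times> {..<K * d} - ?h ` R. ?g p = 0"
    proof
      fix p assume p: "p \<in> {..<K * d} \<times> {..<K * d} - ?h ` R"
      obtain x y where xy: "p = (x, y)" by fastforce
      have "p \<in> ?h ` R"
        if *: "x div d = \<sigma> (y mod d)" "y div d = \<sigma> (y mod d)" "(x mod d, y mod d) \<in> R"
      proof (rule image_eqI)
        show "p = ?h (x mod d, y mod d)"
          using div_mult_mod_eq[of x d] div_mult_mod_eq[of y d] *(1,2) by (simp add: xy)
      qed (rule *(3))
      then show "?g p = 0"
        using p xy by (auto simp: cell_state_def)
    qed
  qed simp
  also have "\<dots> = (\<Sum>p\<in>R. ?g (?h p))"
    by (simp add: sum.reindex[OF inj] comp_def)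
  also have "\<dots> = inner_on R \<phi> \<psi>"
    unfolding inner_on_def
  proof (rule sum.cong)
    fix p assume p: "p \<in> R"
    obtain i j where ij: "p = (i, j)" "i < d" "j < d" using p R by auto
    then show "?g (?h p) = cnj (\<phi> $$ p) * \<psi> $$ p"
      using p bound[OF \<sigma>[OF ij(3)]] by (simp add: cell_state_def)
  qed simp
  finally show ?thesis .
qed

definition cells_separable ::
    "nat \<Rightarrow> nat \<Rightarrow> (nat \<Rightarrow> nat) \<Rightarrow> 'i set \<Rightarrow> ('i \<Rightarrow> complex mat) \<Rightarrow> (nat \<times> nat) set \<Rightarrow> bool" where
  "cells_separable K d \<sigma> I \<psi> R \<longleftrightarrow>
     locc_separates (K * d) (K * d) I (\<lambda>i. cell_state K d \<sigma> R (\<psi> i))"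

text \<open>Alice's ancilla \<open>x div d\<close> carries the label \<open>\<sigma> j\<close>, so
  although she cannot see \<open>j\<close> itself she can project on any condition on the label and
  her own index.\<close>

lemma cells_separable_Alice:
  assumes "cells_separable K d \<sigma> I \<psi> {(i, j) \<in> R. Z (\<sigma> j) i}"
    and "cells_separable K d \<sigma> I \<psi> {(i, j) \<in> R. \<not> Z (\<sigma> j) i}"
  shows "cells_separable K d \<sigma> I \<psi> R"
  unfolding cells_separable_def
proof (rule locc_separates_rows[where f = "\<lambda>x. if Z (x div d) (x mod d) then 0 else 1" and k = 2])
  fix s :: nat assume "s < 2"
  then consider "s = 0" | "s = 1" by linarith
  then show "locc_separates (K * d) (K * d) I (\<lambda>i. restrict_mat
      (\<lambda>x y. (if Z (x div d) (x mod d) then 0 else 1) = s) (cell_state K d \<sigma> R (\<psi> i)))"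
  proof cases
    case 1
    have "restrict_mat (\<lambda>x y. (if Z (x div d) (x mod d) then 0 else 1) = s) (cell_state K d \<sigma> R (\<psi> i)) =
        cell_state K d \<sigma> {(i, j) \<in> R. Z (\<sigma> j) i} (\<psi> i)" for i
      by (rule eq_matI) (auto simp: restrict_mat_def cell_state_def 1)
    then show ?thesis using assms(1) by (simp add: cells_separable_def)
  next
    case 2
    have "restrict_mat (\<lambda>x y. (if Z (x div d) (x mod d) then 0 else 1) = s) (cell_state K d \<sigma> R (\<psi> i)) =
        cell_state K d \<sigma> {(i, j) \<in> R. \<not> Z (\<sigma> j) i} (\<psi> i)" for i
      by (rule eq_matI) (auto simp: restrict_mat_def cell_state_def 2)
    then show ?thesis using assms(2) by (simp add: cells_separable_def)
  qed
qed auto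

lemma cells_separable_Bob:
  assumes "cells_separable K d \<sigma> I \<psi> {(i, j) \<in> R. Z j}"
    and "cells_separable K d \<sigma> I \<psi> {(i, j) \<in> R. \<not> Z j}"
  shows "cells_separable K d \<sigma> I \<psi> R"
  unfolding cells_separable_def
proof (rule locc_separates_columns[where f = "\<lambda>y. if Z (y mod d) then 0 else 1" and k = 2])
  fix s :: nat assume "s < 2"
  then consider "s = 0" | "s = 1" by linarith
  then show "locc_separates (K * d) (K * d) I (\<lambda>i. restrict_mat
      (\<lambda>x y. (if Z (y mod d) then 0 else 1) = s) (cell_state K d \<sigma> R (\<psi> i)))"
  proof cases
    case 1
    have "restrict_mat (\<lambda>x y. (if Z (y mod d) then 0 else 1) = s) (cell_state K d \<sigma> R (\<psi> i)) =
        cell_state K d \<sigma> {(i, j) \<in> R. Z j} (\<psi> i)" for i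
      by (rule eq_matI) (auto simp: restrict_mat_def cell_state_def 1)
    then show ?thesis using assms(1) by (simp add: cells_separable_def)
  next
    case 2
    have "restrict_mat (\<lambda>x y. (if Z (y mod d) then 0 else 1) = s) (cell_state K d \<sigma> R (\<psi> i)) =
        cell_state K d \<sigma> {(i, j) \<in> R. \<not> Z j} (\<psi> i)" for i
      by (rule eq_matI) (auto simp: restrict_mat_def cell_state_def 2)
    then show ?thesis using assms(2) by (simp add: cells_separable_def)
  qed
qed auto

text \<open>One row of the grid may spread over several rows of the large matrix, as Alice's ancilla
  follows Bob's label. Both ancillas agree, so column \<open>y\<close> meets only the row with
  ancilla part \<open>y div d\<close>: the case for the Fourier measurement.\<close>

lemma cells_separable_row:
  assumes "finite I" and R: "R \<subseteq> {r} \<times> {..<d}" "r < d" and \<sigma>: "\<And>j. j < d \<Longrightarrow> \<sigma> j < K"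
    and orth: "\<And>i j. i \<in> I \<Longrightarrow> j \<in> I \<Longrightarrow> i \<noteq> j \<Longrightarrow> inner_on R (\<psi> i) (\<psi> j) = 0"
  shows "cells_separable K d \<sigma> I \<psi> R"
  unfolding cells_separable_def
proof (rule locc_separates_one_row_per_column[where \<rho> = "\<lambda>y. y div d * d + r"])
  have sub: "R \<subseteq> {..<d} \<times> {..<d}" using R by auto
  show "state_inner (cell_state K d \<sigma> R (\<psi> i)) (cell_state K d \<sigma> R (\<psi> j)) = 0"
    if "i \<in> I" "j \<in> I" "i \<noteq> j" for i j
    using state_inner_cell_state[OF sub \<sigma>] orth[OF that] by simp
  show "cell_state K d \<sigma> R (\<psi> i) $$ (x, y) = 0"
    if "x < K * d" "y < K * d" "x \<noteq> y div d * d + r" for i x y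
  proof -
    have "\<not> (x div d = y div d \<and> x mod d = r)"
      using that(3) div_mult_mod_eq[of x d] by metis
    then have "\<not> (x div d = \<sigma> (y mod d) \<and> y div d = \<sigma> (y mod d) \<and> (x mod d, y mod d) \<in> R)"
      using R by auto
    then show ?thesis using that by (auto simp: cell_state_def)
  qed
qed (use assms in auto)

text \<open>With \<open>j = c\<close> fixed the label is the constant \<open>\<sigma> c\<close>, so
  only one column of the large matrix is occupied and Alice can measure directly.\<close>

lemma cells_separable_column:
  assumes "finite I" and R: "R \<subseteq> {..<d} \<times> {c}" "c < d" and \<sigma>: "\<And>j. j < d \<Longrightarrow> \<sigma> j < K"
    and orth: "\<And>i j. i \<in> I \<Longrightarrow> j \<in> I \<Longrightarrow> i \<noteq> j \<Longrightarrow> inner_on R (\<psi> i) (\<psi> j) = 0"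
  shows "cells_separable K d \<sigma> I \<psi> R"
  unfolding cells_separable_def
proof (rule locc_separates_one_column[where c = "\<sigma> c * d + c"])
  have sub: "R \<subseteq> {..<d} \<times> {..<d}" using R by auto
  show "state_inner (cell_state K d \<sigma> R (\<psi> i)) (cell_state K d \<sigma> R (\<psi> j)) = 0"
    if "i \<in> I" "j \<in> I" "i \<noteq> j" for i j
    using state_inner_cell_state[OF sub \<sigma>] orth[OF that] by simp
  show "cell_state K d \<sigma> R (\<psi> i) $$ (x, y) = 0"
    if "x < K * d" "y < K * d" "y \<noteq> \<sigma> c * d + c" for i x y
  proof -
    have "\<not> (y div d = \<sigma> c \<and> y mod d = c)"
      using that(3) div_mult_mod_eq[of y d] by metis
    then have "\<not> (x div d = \<sigma> (y mod d) \<and> y div d = \<sigma> (y mod d) \<and> (x mod d, y mod d) \<in> R)"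
      using R by auto
    then show ?thesis using that by (auto simp: cell_state_def)
  qed
qed (use assms in auto)

section \<open>Peeling off the layers of tiles\<close>

text \<open>The frame of the square with both coordinates in \<open>{t..d - 1 - t}\<close>, cut like
  a pinwheel: \<open>q = 0, 1, 2, 3\<close> are its top, right, bottom and left sides (Alice's index
  counting rows), each without one corner, in the order of \<open>tile_states\<close>.\<close>

definition tile :: "nat \<Rightarrow> nat \<Rightarrow> nat \<Rightarrow> (nat \<times> nat) set" where
  "tile d t q =
     (if q = 0 then {t} \<times> {t..d - 2 - t}
      else if q = 1 then {t..d - 2 - t} \<times> {d - 1 - t}
      else if q = 2 then {d - 1 - t} \<times> {t + 1..d - 1 - t}
      else {t + 1..d - 1 - t} \<times> {t})"

text \<open>Each layer loses tile 0, then 1, then 3, then 2, and the next square remains. The only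
  label Alice consults is that of column \<open>d - 1 - t\<close>, which is why
  \<open>\<sigma>_inj\<close> speaks of these columns; the others may share a label.\<close>

lemma cells_separable_square:
  assumes fin: "finite I" and d: "d = 2 * r + 1" and \<sigma>: "\<And>j. j < d \<Longrightarrow> \<sigma> j < K"
    and \<sigma>_inj: "\<And>t j. t < r \<Longrightarrow> j < d \<Longrightarrow> \<sigma> j = \<sigma> (d - 1 - t) \<Longrightarrow> j = d - 1 - t"
    and orth: "\<And>t q i j. t < r \<Longrightarrow> q < 4 \<Longrightarrow> i \<in> I \<Longrightarrow> j \<in> I \<Longrightarrow> i \<noteq> j \<Longrightarrow>
      inner_on (tile d t q) (\<psi> i) (\<psi> j) = 0"
    and orth_centre: "\<And>i j. i \<in> I \<Longrightarrow> j \<in> I \<Longrightarrow> i \<noteq> j \<Longrightarrow> inner_on {(r, r)} (\<psi> i) (\<psi> j) = 0"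
  shows "cells_separable K d \<sigma> I \<psi> ({0..d - 1} \<times> {0..d - 1})"
proof -
  let ?H = "cells_separable K d \<sigma> I \<psi>"
  have "?H ({t..d - 1 - t} \<times> {t..d - 1 - t})" if "t \<le> r" for t
    using that
  \<comment> \<open>The induction descends from \<open>t = r\<close>, where the square is the centre
    cell, to the whole grid at \<open>t = 0\<close>.\<close>
  proof (induction t rule: inc_induct)
    case base
    have "{r..d - 1 - r} \<times> {r..d - 1 - r} = {(r, r)}"
      using d by auto
    then show ?case
      using cells_separable_row[OF fin _ _ \<sigma> orth_centre, of r] d by simp
  next
    case (step t)
    have t: "t < r" by (rule step)
    let ?e = "d - 1 - t"
    \<comment> \<open>Within the current square the label tells the last column from all the
      others.\<close>
    have \<sigma>e: "\<sigma> j = \<sigma> ?e \<longleftrightarrow> j = ?e" if "j \<le> d - 1 - t" for j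
      using \<sigma>_inj[OF t, of j] that d by auto
    have row: "?H (tile d t q)" if "q = 0 \<or> q = 2" for q
    proof -
      have sub: "tile d t q \<subseteq> {if q = 0 then t else ?e} \<times> {..<d}" and lt: "(if q = 0 then t else ?e) < d"
        and "q < 4"
        using that d t by (auto simp: tile_def)
      from orth[OF t \<open>q < 4\<close>] show ?thesis
        by (intro cells_separable_row[OF fin sub lt] \<sigma>)
    qed
    have column: "?H (tile d t q)" if "q = 1 \<or> q = 3" for q
    proof -
      have sub: "tile d t q \<subseteq> {..<d} \<times> {if q = 1 then ?e else t}" and lt: "(if q = 1 then ?e else t) < d"
        and "q < 4"
        using that d t by (auto simp: tile_def)
      from orth[OF t \<open>q < 4\<close>] show ?thesis
        by (intro cells_separable_column[OF fin sub lt] \<sigma>)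
    qed
    \<comment> \<open>\<open>R1\<close>, \<open>R2\<close>, \<open>R3\<close> are what is left after
      cutting off tiles 0, 1 and 3. The protocol runs in that order, while the argument goes
      backwards from the inner square.\<close>
    define R1 where "R1 = {(i, j) \<in> {t..?e} \<times> {t..?e}. \<not> (i = t \<and> j \<noteq> ?e)}"
    define R2 where "R2 = {(i, j) \<in> R1. \<not> (i \<le> d - 2 - t \<and> j = ?e)}"
    define R3 where "R3 = {(i, j) \<in> R2. j \<noteq> t}"
    have "{(i, j) \<in> R3. \<not> i = ?e} = {Suc t..d - 1 - Suc t} \<times> {Suc t..d - 1 - Suc t}"
      using t d unfolding R3_def R2_def R1_def by auto
    moreover have "{(i, j) \<in> R3. i = ?e} = tile d t 2"
      using t d unfolding R3_def R2_def R1_def tile_def by auto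
    ultimately have "?H R3"
      using cells_separable_Alice[of K d \<sigma> I \<psi> R3 "\<lambda>a i. i = ?e"] row[of 2] step.IH by simp
    \<comment> \<open>The corner \<open>(t, t)\<close> went with tile 0, so column \<open>t\<close>
      of \<open>R2\<close> is exactly tile 3 and Bob can cut it off.\<close>
    moreover have "{(i, j) \<in> R2. j = t} = tile d t 3"
      using t d unfolding R2_def R1_def tile_def by auto
    ultimately have "?H R2"
      using cells_separable_Bob[of K d \<sigma> I \<psi> R2 "\<lambda>j. j = t"] column[of 3] by (simp add: R3_def)
    moreover have "{(i, j) \<in> R1. i \<le> d - 2 - t \<and> \<sigma> j = \<sigma> ?e} = tile d t 1"
      using t d \<sigma>e unfolding R1_def tile_def by auto
    moreover have "{(i, j) \<in> R1. \<not> (i \<le> d - 2 - t \<and> \<sigma> j = \<sigma> ?e)} = R2"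
      using \<sigma>e unfolding R2_def R1_def by auto
    ultimately have "?H R1"
      using cells_separable_Alice[of K d \<sigma> I \<psi> R1 "\<lambda>a i. i \<le> d - 2 - t \<and> a = \<sigma> ?e"] column[of 1]
      by simp
    moreover have "{(i, j) \<in> {t..?e} \<times> {t..?e}. i = t \<and> \<sigma> j \<noteq> \<sigma> ?e} = tile d t 0"
      using t d \<sigma>e unfolding tile_def by auto
    moreover have "{(i, j) \<in> {t..?e} \<times> {t..?e}. \<not> (i = t \<and> \<sigma> j \<noteq> \<sigma> ?e)} = R1"
      using \<sigma>e unfolding R1_def by auto
    ultimately show ?case
      using cells_separable_Alice[of K d \<sigma> I \<psi> "{t..?e} \<times> {t..?e}" "\<lambda>a i. i = t \<and> a \<noteq> \<sigma> ?e"] row[of 0]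
      by simp
  qed
  from this[of 0] show ?thesis by simp
qed

section \<open>Sharing a label of Bob's index\<close>

text \<open>The copies form one unnormalised maximally entangled state of dimension
  \<open>2 ^ r\<close>: a Kronecker product of identities is an identity.\<close>

lemma bell_copies_eq: "bell_copies r = 1\<^sub>m (2 ^ r)"
proof (induction r)
  case (Suc r)
  have bell: "bell_pair = 1\<^sub>m 2"
    by (rule eq_matI) (auto simp: bell_pair_def prod_state_def less_2_cases_iff)
  show ?case
    unfolding bell_copies.simps Suc bell
  proof (rule eq_matI)
    fix x y :: nat
    assume "x < dim_row (1\<^sub>m (2 ^ Suc r) :: complex mat)" "y < dim_col (1\<^sub>m (2 ^ Suc r) :: complex mat)"
    then have xy: "x < 2 * 2 ^ r" "y < 2 * 2 ^ r" by auto
    then have "x div 2 ^ r < 2" "y div 2 ^ r < 2"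
      by (simp_all add: less_mult_imp_div_less)
    moreover have "x = y \<longleftrightarrow> x div 2 ^ r = y div 2 ^ r \<and> x mod 2 ^ r = y mod 2 ^ r"
      by (metis div_mult_mod_eq)
    ultimately show "joint_state (1\<^sub>m 2) (1\<^sub>m (2 ^ r)) $$ (x, y) = (1\<^sub>m (2 ^ Suc r) :: complex mat) $$ (x, y)"
      using xy by (auto simp: joint_state_def)
  qed (auto simp: joint_state_def)
qed simp

text \<open>Bob measures the difference modulo \<open>K\<close> between his ancilla and
  \<open>l j\<close>. Outcome \<open>s\<close> fixes his ancilla to \<open>l j + s\<close> modulo
  \<open>K\<close>, and Alice's ancilla, equal to his, acquires the same label.\<close>

lemma locc_separates_joint_state:
  assumes \<psi>: "\<And>i. i \<in> I \<Longrightarrow> \<psi> i \<in> carrier_mat d d" and "d > 0"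
    and l: "\<And>j. j < d \<Longrightarrow> l j < K"
    and sep: "\<And>s. s < K \<Longrightarrow> cells_separable K d
      (\<lambda>j. if l j + s < K then l j + s else l j + s - K) I \<psi> ({0..d - 1} \<times> {0..d - 1})"
  shows "locc_separates (K * d) (K * d) I (\<lambda>i. joint_state (1\<^sub>m K) (\<psi> i))"
proof -
  \<comment> \<open>\<open>?f\<close> subtracts and \<open>?\<sigma> s\<close> adds modulo
    \<open>K\<close>, both written as case distinctions on natural numbers.\<close>
  let ?f = "\<lambda>y. if l (y mod d) \<le> y div d then y div d - l (y mod d) else y div d + K - l (y mod d)"
  let ?\<sigma> = "\<lambda>s j. if l j + s < K then l j + s else l j + s - K"
  have div: "x div d < K" if "x < K * d" for x
    using that by (simp add: less_mult_imp_div_less)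
  have mod: "x mod d < d" for x
    using \<open>d > 0\<close> by simp
  show ?thesis
  proof (rule locc_separates_columns[where f = ?f and k = K])
    show "joint_state (1\<^sub>m K) (\<psi> i) \<in> carrier_mat (K * d) (K * d)" if "i \<in> I" for i
      using \<psi>[OF that] by (auto simp: joint_state_def)
    show "?f y < K" if "y < K * d" for y
      using div[OF that] l[OF mod, of y] by auto
    fix s assume s: "s < K"
    have "restrict_mat (\<lambda>x y. ?f y = s) (joint_state (1\<^sub>m K) (\<psi> i)) =
        cell_state K d (?\<sigma> s) ({0..d - 1} \<times> {0..d - 1}) (\<psi> i)" if i: "i \<in> I" for i
    proof (rule eq_matI)
      fix x y
      assume "x < dim_row (cell_state K d (?\<sigma> s) ({0..d - 1} \<times> {0..d - 1}) (\<psi> i))"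
        "y < dim_col (cell_state K d (?\<sigma> s) ({0..d - 1} \<times> {0..d - 1}) (\<psi> i))"
      then have xy: "x < K * d" "y < K * d" by (auto simp: cell_state_def)
      have f_iff: "?f y = s \<longleftrightarrow> y div d = ?\<sigma> s (y mod d)"
        using div[OF xy(2)] l[OF mod, of y] s by auto
      have mod_le: "x mod d \<le> d - 1" "y mod d \<le> d - 1"
        using mod[of x] mod[of y] by linarith+
      have "restrict_mat (\<lambda>x y. ?f y = s) (joint_state (1\<^sub>m K) (\<psi> i)) $$ (x, y) =
          (if ?f y = s \<and> x div d = y div d then \<psi> i $$ (x mod d, y mod d) else 0)"
        using xy \<psi>[OF i] div[OF xy(1)] div[OF xy(2)] by (auto simp: restrict_mat_def joint_state_def)
      also have "\<dots> = cell_state K d (?\<sigma> s) ({0..d - 1} \<times> {0..d - 1}) (\<psi> i) $$ (x, y)"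
        unfolding f_iff using xy mod_le by (auto simp: cell_state_def)
      finally show "restrict_mat (\<lambda>x y. ?f y = s) (joint_state (1\<^sub>m K) (\<psi> i)) $$ (x, y) =
          cell_state K d (?\<sigma> s) ({0..d - 1} \<times> {0..d - 1}) (\<psi> i) $$ (x, y)" .
    qed (use \<psi>[OF i] in \<open>auto simp: restrict_mat_def joint_state_def cell_state_def\<close>)
    then show "locc_separates (K * d) (K * d) I (\<lambda>i. restrict_mat (\<lambda>x y. ?f y = s) (joint_state (1\<^sub>m K) (\<psi> i)))"
      using sep[OF s] unfolding cells_separable_def by (subst locc_separates_cong)
  qed
qed

lemma locc_separates_tiled:
  assumes fin: "finite I" and d: "d = 2 * r + 1" and K: "r < K"
    and \<psi>: "\<And>i. i \<in> I \<Longrightarrow> \<psi> i \<in> carrier_mat d d"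
    and orth: "\<And>t q i j. t < r \<Longrightarrow> q < 4 \<Longrightarrow> i \<in> I \<Longrightarrow> j \<in> I \<Longrightarrow> i \<noteq> j \<Longrightarrow>
      inner_on (tile d t q) (\<psi> i) (\<psi> j) = 0"
    and orth_centre: "\<And>i j. i \<in> I \<Longrightarrow> j \<in> I \<Longrightarrow> i \<noteq> j \<Longrightarrow> inner_on {(r, r)} (\<psi> i) (\<psi> j) = 0"
  shows "locc_separates (K * d) (K * d) I (\<lambda>i. joint_state (1\<^sub>m K) (\<psi> i))"
proof -
  \<comment> \<open>Each column right of the centre gets its own label \<open>d - 1 - j\<close>,
    which is below \<open>r\<close>; all others share \<open>r\<close>. These \<open>r + 1\<close>
    labels fit since \<open>r < K\<close>.\<close>
  define l where "l j = (if j > r then d - 1 - j else r)" for j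
  have l: "l j < K" if "j < d" for j
    using that d K by (auto simp: l_def)
  show ?thesis
  proof (rule locc_separates_joint_state[OF \<psi> _ l])
    fix s assume s: "s < K"
    show "cells_separable K d (\<lambda>j. if l j + s < K then l j + s else l j + s - K) I \<psi>
        ({0..d - 1} \<times> {0..d - 1})"
    proof (rule cells_separable_square[OF fin d _ _ orth orth_centre])
      show "(if l j + s < K then l j + s else l j + s - K) < K" if "j < d" for j
        using l[OF that] s by auto
      show "j = d - 1 - t"
        if "t < r" "j < d"
          "(if l j + s < K then l j + s else l j + s - K) =
           (if l (d - 1 - t) + s < K then l (d - 1 - t) + s else l (d - 1 - t) + s - K)" for t j
      proof -
        have e: "d - 1 - t < d" using d by simp
        have "l (d - 1 - t) = t"
          using that(1) d by (auto simp: l_def)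
        \<comment> \<open>The cyclic shift by \<open>s\<close> is injective on labels below
          \<open>K\<close>.\<close>
        moreover have "l j = l (d - 1 - t)"
          using that(3) l[OF that(2)] l[OF e] s by (auto split: if_splits)
        ultimately show ?thesis
          using that(1,2) d by (auto simp: l_def split: if_splits)
      qed
    qed
  qed (use d in auto)
qed

section \<open>The tile states\<close>

text \<open>The stopper is given the index \<open>(0, 0, 0)\<close>: on every tile it agrees with the missing phase \<open>k = 0\<close>.\<close>

definition tile_pos :: "nat \<Rightarrow> nat \<times> nat \<Rightarrow> nat" where
  "tile_pos q p = (if even q then snd p else fst p)"

text \<open>\<open>k = 0\<close> is tested before the tile, so such an index denotes the stopper
  whatever \<open>t\<close> and \<open>q\<close> are; \<open>state_indices\<close> admits just one
  of them.\<close>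

fun indexed_state :: "nat \<Rightarrow> nat \<times> nat \<times> nat \<Rightarrow> complex mat" where
  "indexed_state d (t, q, k) = mat d d (\<lambda>p.
     if k = 0 then 1 else if p \<in> tile d t q then omega d t ^ (tile_pos q p * k) else 0)"

definition state_indices :: "nat \<Rightarrow> (nat \<times> nat \<times> nat) set" where
  "state_indices r = insert (0, 0, 0) (SIGMA t:{..<r}. {..<4} \<times> {1..2 * r - 1 - 2 * t})"

lemma finite_state_indices [simp]: "finite (state_indices r)"
  by (simp add: state_indices_def)

lemma indexed_state_carrier [simp]: "indexed_state d a \<in> carrier_mat d d"
  by (cases a) simp

lemma sum_odd: "(\<Sum>t<r. 2 * t + 1) = (r :: nat)\<^sup>2"
  by (induction r) (auto simp: power2_eq_square)

text \<open>Layer \<open>t\<close> contributes four tiles with \<open>2 * (r - 1 - t) + 1\<close>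
  phases each; these are the first \<open>r\<close> odd numbers in reverse order, with sum the
  square of \<open>r\<close>.\<close>

lemma card_state_indices: "card (state_indices r) = (2 * r)\<^sup>2 + 1"
proof -
  have "card (state_indices r) = Suc (\<Sum>t<r. 4 * (2 * r - 1 - 2 * t))"
    by (simp add: state_indices_def)
  also have "(\<Sum>t<r. 4 * (2 * r - 1 - 2 * t)) = (\<Sum>t<r. 4 * (2 * (r - Suc t) + 1))"
    by (intro sum.cong) auto
  also have "\<dots> = (\<Sum>t<r. 4 * (2 * t + 1))"
    by (rule sum.nat_diff_reindex)
  also have "\<dots> = 4 * r\<^sup>2"
    by (simp only: sum_odd flip: sum_distrib_left)
  finally show ?thesis
    by (simp add: power_mult_distrib)
qed

lemma tile_states_eq:
  assumes "d = 2 * r + 1" "t < r" "k \<ge> 1"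
  shows "tile_states d t k = (\<lambda>q. indexed_state d (t, q, k)) ` {..<4}"
proof -
  have "{..<4 :: nat} = {0, 1, 2, 3}" by auto
  moreover have "prod_state (unit_vec d t) (phase_vec d t k t (d - 2 - t)) = indexed_state d (t, 0, k)"
    "prod_state (phase_vec d t k t (d - 2 - t)) (unit_vec d (d - 1 - t)) = indexed_state d (t, 1, k)"
    "prod_state (unit_vec d (d - 1 - t)) (phase_vec d t k (t + 1) (d - 1 - t)) = indexed_state d (t, 2, k)"
    "prod_state (phase_vec d t k (t + 1) (d - 1 - t)) (unit_vec d t) = indexed_state d (t, 3, k)"
    using assms
    by (auto intro!: eq_matI simp: prod_state_def phase_vec_def tile_def tile_pos_def)
  ultimately show ?thesis
    unfolding tile_states_def by simp
qed

lemma UN_image_Sigma: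
  "(\<Union>t\<in>T. \<Union>k\<in>K t. (\<lambda>q. g (t, q, k)) ` A) = g ` (SIGMA t:T. A \<times> K t)"
  by (force simp: image_iff)

lemma U_states_eq:
  assumes "d = 2 * r + 1" "r \<ge> 1"
  shows "U_states d = indexed_state d ` state_indices r"
proof -
  have "stopper d = indexed_state d (0, 0, 0)"
    by (rule eq_matI) (auto simp: stopper_def prod_state_def)
  moreover have "{0..(d - 3) div 2} = {..<r}"
    using assms by auto
  moreover have "d - 2 - 2 * t = 2 * r - 1 - 2 * t" for t
    using assms by simp
  moreover have "(\<Union>t<r. \<Union>k\<in>{1..2 * r - 1 - 2 * t}. tile_states d t k) =
      (\<Union>t<r. \<Union>k\<in>{1..2 * r - 1 - 2 * t}. (\<lambda>q. indexed_state d (t, q, k)) ` {..<4})"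
    by (intro SUP_cong refl tile_states_eq[OF assms(1)]) (simp_all only: lessThan_iff atLeastAtMost_iff)
  ultimately show ?thesis
    by (simp only: U_states_def state_indices_def UN_image_Sigma[where g = "indexed_state d"] image_insert Un_insert_right Un_empty_right)
qed

section \<open>Tiles as sequences of cells, and the states restricted to them\<close>

definition tile_cell :: "nat \<Rightarrow> nat \<Rightarrow> nat \<Rightarrow> nat \<Rightarrow> nat \<times> nat" where
  "tile_cell d t q s =
     (if q = 0 then (t, t + s) else if q = 1 then (t + s, d - 1 - t)
      else if q = 2 then (d - 1 - t, t + 1 + s) else (t + 1 + s, t))"

lemma tile_eq_image:
  assumes "d = 2 * r + 1" "t < r"
  shows "tile d t q = tile_cell d t q ` {..<d - 1 - 2 * t}"
proof
  show "tile_cell d t q ` {..<d - 1 - 2 * t} \<subseteq> tile d t q"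
    using assms by (auto simp: tile_def tile_cell_def)
  show "tile d t q \<subseteq> tile_cell d t q ` {..<d - 1 - 2 * t}"
  proof
    fix p assume p: "p \<in> tile d t q"
    show "p \<in> tile_cell d t q ` {..<d - 1 - 2 * t}"
      by (rule image_eqI[of _ _
            "if q = 0 then snd p - t else if q = 1 then fst p - t else if q = 2 then snd p - (t + 1)
             else fst p - (t + 1)"])
        (use p assms in \<open>auto simp: tile_def tile_cell_def split: if_splits\<close>)
  qed
qed

lemma inj_tile_cell: "inj (tile_cell d t q)"
  by (auto simp: inj_def tile_cell_def)

lemma tile_pos_cell:
  assumes "q < 4"
  shows "tile_pos q (tile_cell d t q s) = (if q < 2 then t else t + 1) + s"
proof -
  have "q \<in> {0, 1, 2, 3}" using assms by auto
  then show ?thesis by (auto simp: tile_pos_def tile_cell_def)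
qed

text \<open>The layer of a tile is the distance of its cells from the border of the grid, which
  makes tiles of different layers disjoint.\<close>

lemma tile_layer:
  assumes "d = 2 * r + 1" "t < r" "(i, j) \<in> tile d t q"
  shows "min (min i j) (min (d - 1 - i) (d - 1 - j)) = t"
  using assms by (auto simp: tile_def min_def split: if_splits)

lemma tile_disjoint:
  assumes "d = 2 * r + 1" "t < r" "t' < r" "q < 4" "q' < 4" "p \<in> tile d t q" "p \<in> tile d t' q'"
  shows "t = t' \<and> q = q'"
proof -
  obtain i j where p: "p = (i, j)" by fastforce
  have "t = t'"
    using tile_layer[OF assms(1,2)] tile_layer[OF assms(1,3)] assms(6,7) unfolding p by metis
  define e where "e = d - 1 - t"
  have e: "t < e" using assms(1,2) by (simp add: e_def)
  \<comment> \<open>With \<open>t\<close> and \<open>e\<close> the extremes of the square, the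
    strict inequalities record which corner each side omits; this decides the side of a cell within
    a layer.\<close>
  have mem: "q = 0 \<and> i = t \<and> j < e \<or> q = 1 \<and> j = e \<and> i < e \<or> q = 2 \<and> i = e \<and> t < j \<or> q \<ge> 3 \<and> j = t \<and> t < i"
    if "(i, j) \<in> tile d t q" for q
    using that assms(1,2) by (auto simp: tile_def e_def split: if_splits)
  have "q = q'"
    using mem[of q] mem[of q'] assms(4-7) e unfolding p \<open>t = t'\<close>[symmetric] by linarith
  with \<open>t = t'\<close> show ?thesis ..
qed

lemma tile_subset:
  assumes "d = 2 * r + 1" "t < r"
  shows "tile d t q \<subseteq> {..<d} \<times> {..<d}"
  using assms by (auto simp: tile_def)

lemma omega_eq: "omega d t = cis (2 * pi / real (d - 1 - 2 * t))"
  by (simp add: omega_def cis_conv_exp mult_ac)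

lemma indexed_state_on_tile:
  assumes d: "d = 2 * r + 1" and t: "t < r" and q: "q < 4" and p: "p \<in> tile d t q"
    and a: "(t', q', k') \<in> state_indices r"
  shows "indexed_state d (t', q', k') $$ p =
    (if k' = 0 \<or> (t', q') = (t, q) then omega d t ^ (tile_pos q p * k') else 0)"
proof -
  obtain i j where ij: "p = (i, j)" "i < d" "j < d"
    using p tile_subset[OF d t] by blast
  show ?thesis
  proof (cases "k' = 0")
    case False
    then have "t' < r" "q' < 4" using a by (auto simp: state_indices_def)
    then have "p \<in> tile d t' q' \<longleftrightarrow> (t', q') = (t, q)"
      using tile_disjoint[OF d t _ q _ p] p by auto
    then show ?thesis using False ij by auto
  qed (use ij in simp)
qed

text \<open>On a tile of \<open>n\<close> cells only its own states and the stopper survive. Their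
  phases are distinct and below \<open>n\<close>, so they restrict to distinct characters, which are
  orthogonal. The second part, with squared norm \<open>n\<close>, serves to prove the states
  different.\<close>

lemma inner_on_tile:
  assumes d: "d = 2 * r + 1" and t: "t < r" and q: "q < 4"
    and a: "a \<in> state_indices r" and b: "b \<in> state_indices r"
  shows "a \<noteq> b \<Longrightarrow> inner_on (tile d t q) (indexed_state d a) (indexed_state d b) = 0"
    and "a = (t, q, k) \<Longrightarrow> inner_on (tile d t q) (indexed_state d a) (indexed_state d a) \<noteq> 0"
proof -
  define n where "n = d - 1 - 2 * t"
  define \<zeta> where "\<zeta> = omega d t"
  have n: "n > 0" using d t by (simp add: n_def)
  define l where "l = (if q < 2 then t else t + 1)"
  have inner_sum: "inner_on (tile d t q) \<phi> \<chi> = (\<Sum>s<n. cnj (\<phi> $$ tile_cell d t q s) * \<chi> $$ tile_cell d t q s)" for \<phi> \<chi>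
    unfolding inner_on_def tile_eq_image[OF d t] n_def
    by (subst sum.reindex) (auto intro: inj_on_subset[OF inj_tile_cell])
  have cell: "indexed_state d (t', q', k') $$ tile_cell d t q s =
      (if k' = 0 \<or> (t', q') = (t, q) then \<zeta> ^ ((l + s) * k') else 0)"
    if "(t', q', k') \<in> state_indices r" "s < n" for t' q' k' s
  proof -
    have "tile_cell d t q s \<in> tile d t q"
      using that(2) unfolding tile_eq_image[OF d t] n_def by blast
    from indexed_state_on_tile[OF d t q this that(1)] show ?thesis
      by (simp only: tile_pos_cell[OF q] \<zeta>_def l_def)
  qed
  have inner: "inner_on (tile d t q) (indexed_state d (t1, q1, k1)) (indexed_state d (t2, q2, k2)) =
      (if (k1 = 0 \<or> (t1, q1) = (t, q)) \<and> (k2 = 0 \<or> (t2, q2) = (t, q)) then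
         (if k1 = k2 then of_nat n else 0) else 0)"
    if "(t1, q1, k1) \<in> state_indices r" "(t2, q2, k2) \<in> state_indices r" for t1 q1 k1 t2 q2 k2
  proof (cases "(k1 = 0 \<or> (t1, q1) = (t, q)) \<and> (k2 = 0 \<or> (t2, q2) = (t, q))")
    case True
    \<comment> \<open>The stopper has phase 0 and the states of the tile have phases 1 to
      \<open>n - 1\<close>, together one full period.\<close>
    have "k1 < n" "k2 < n"
      using True that n d by (auto simp: state_indices_def n_def)
    have "inner_on (tile d t q) (indexed_state d (t1, q1, k1)) (indexed_state d (t2, q2, k2)) =
        (\<Sum>s<n. cnj (\<zeta> ^ ((l + s) * k1)) * \<zeta> ^ ((l + s) * k2))"
      unfolding inner_sum
      by (intro sum.cong refl) (simp only: cell[OF that(1)] cell[OF that(2)] lessThan_iff True if_True)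
    also have "\<dots> = (if k1 = k2 then of_nat n else 0)"
      unfolding \<zeta>_def omega_eq n_def[symmetric]
      by (rule sum_roots_of_unity[OF n \<open>k1 < n\<close> \<open>k2 < n\<close>])
    finally show ?thesis using True by (simp only: if_True simp_thms)
  next
    case False
    have "inner_on (tile d t q) (indexed_state d (t1, q1, k1)) (indexed_state d (t2, q2, k2)) = (\<Sum>s<n. 0)"
      unfolding inner_sum
      by (intro sum.cong refl) (use False in \<open>auto simp only: cell[OF that(1)] cell[OF that(2)]
        lessThan_iff mult_zero_left mult_zero_right complex_cnj_zero if_False split: if_split\<close>)
    then show ?thesis using False by (simp only: if_False simp_thms sum.neutral_const)
  qed
  obtain t1 q1 k1 t2 q2 k2 where ab: "a = (t1, q1, k1)" "b = (t2, q2, k2)"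
    by (metis prod_cases3)
  \<comment> \<open>Equal phases would force equal indices: both zero means the stopper twice, and
    otherwise both indices belong to the tile \<open>(t, q)\<close>.\<close>
  show "inner_on (tile d t q) (indexed_state d a) (indexed_state d b) = 0" if "a \<noteq> b"
    using that a b unfolding ab inner[OF a[unfolded ab] b[unfolded ab]]
    by (auto simp: state_indices_def)
  show "inner_on (tile d t q) (indexed_state d a) (indexed_state d a) \<noteq> 0" if "a = (t, q, k)"
    using a n inner[of t q k t q k] unfolding that by simp
qed

section \<open>Orthogonality, distinctness and the centre cell\<close>

lemma state_inner_commute:
  assumes "\<phi> \<in> carrier_mat m n" "\<psi> \<in> carrier_mat m n"
  shows "state_inner \<psi> \<phi> = cnj (state_inner \<phi> \<psi>)"
  unfolding state_inner_carrier[OF assms(1)] state_inner_carrier[OF assms(2)]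
  by (simp add: mult.commute)

lemma state_inner_eq_inner_on:
  assumes \<phi>: "\<phi> \<in> carrier_mat m n" and R: "R \<subseteq> {..<m} \<times> {..<n}"
    and zero: "\<And>p. p \<in> {..<m} \<times> {..<n} \<Longrightarrow> p \<notin> R \<Longrightarrow> \<phi> $$ p = 0"
  shows "state_inner \<phi> \<psi> = inner_on R \<phi> \<psi>"
proof -
  have "state_inner \<phi> \<psi> = (\<Sum>p\<in>{..<m} \<times> {..<n}. cnj (\<phi> $$ p) * \<psi> $$ p)"
    unfolding state_inner_carrier[OF \<phi>] by (simp add: sum.cartesian_product split_def)
  also have "\<dots> = inner_on R \<phi> \<psi>"
    unfolding inner_on_def
  proof (rule sum.mono_neutral_right)
    show "\<forall>p\<in>{..<m} \<times> {..<n} - R. cnj (\<phi> $$ p) * \<psi> $$ p = 0"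
      using zero by (metis DiffD1 DiffD2 complex_cnj_zero mult_zero_left)
  qed (use R in auto)
  finally show ?thesis .
qed

text \<open>A tile state vanishes outside its tile, so the full inner product is the one over that
  tile.\<close>

lemma state_inner_indexed_tile:
  assumes d: "d = 2 * r + 1" and a: "(t, q, k) \<in> state_indices r" "k > 0"
    and b: "b \<in> state_indices r" "(t, q, k) \<noteq> b"
  shows "state_inner (indexed_state d (t, q, k)) (indexed_state d b) = 0"
proof -
  have tq: "t < r" "q < 4" using a by (auto simp: state_indices_def)
  have "state_inner (indexed_state d (t, q, k)) (indexed_state d b) =
      inner_on (tile d t q) (indexed_state d (t, q, k)) (indexed_state d b)"
    by (rule state_inner_eq_inner_on[OF indexed_state_carrier tile_subset[OF d tq(1)]]) (use a(2) in auto)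
  also have "\<dots> = 0"
    by (rule inner_on_tile(1)[OF d tq a(1) b])
  finally show ?thesis .
qed

lemma state_inner_indexed:
  assumes d: "d = 2 * r + 1" and a: "a \<in> state_indices r" and b: "b \<in> state_indices r" and "a \<noteq> b"
  shows "state_inner (indexed_state d a) (indexed_state d b) = 0"
proof -
  obtain t1 q1 k1 t2 q2 k2 where ab: "a = (t1, q1, k1)" "b = (t2, q2, k2)"
    by (metis prod_cases3)
  \<comment> \<open>Only the stopper has phase 0, so one of two different indices belongs to a tile
    state.\<close>
  have "k1 > 0 \<or> k2 > 0"
    using assms unfolding ab by (auto simp: state_indices_def)
  then show ?thesis
  proof
    assume "k1 > 0"
    then show ?thesis using state_inner_indexed_tile[OF d, of t1 q1 k1 b] a b \<open>a \<noteq> b\<close> unfolding ab(1) by blast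
  next
    assume "k2 > 0"
    then have "state_inner (indexed_state d b) (indexed_state d a) = 0"
      using state_inner_indexed_tile[OF d, of t2 q2 k2 a] a b \<open>a \<noteq> b\<close> unfolding ab(2) by blast
    then show ?thesis
      by (subst state_inner_commute[of "indexed_state d b" d d]) (simp_all del: indexed_state.simps)
  qed
qed

text \<open>If two indices gave the same state, one of them would index a tile state, which on its
  tile would be orthogonal to itself and yet have nonzero norm.\<close>

lemma inj_indexed_state:
  assumes d: "d = 2 * r + 1"
  shows "inj_on (indexed_state d) (state_indices r)"
proof (rule inj_onI, rule ccontr)
  fix a b
  assume a: "a \<in> state_indices r" and b: "b \<in> state_indices r"
    and eq: "indexed_state d a = indexed_state d b" and "a \<noteq> b"
  have *: False
    if "(t, q, k) \<in> state_indices r" "c \<in> state_indices r" "(t, q, k) \<noteq> c" "k > 0"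
      "indexed_state d (t, q, k) = indexed_state d c" for t q k c
  proof -
    have "t < r" "q < 4" using that by (auto simp: state_indices_def)
    then show False
      using inner_on_tile[OF d _ _ that(1,2)] that(3,5) by metis
  qed
  obtain t1 q1 k1 t2 q2 k2 where ab: "a = (t1, q1, k1)" "b = (t2, q2, k2)"
    by (metis prod_cases3)
  have "k1 > 0 \<or> k2 > 0"
    using a b \<open>a \<noteq> b\<close> unfolding ab by (auto simp: state_indices_def)
  then show False
    using *[of t1 q1 k1 b] *[of t2 q2 k2 a] a b eq \<open>a \<noteq> b\<close> unfolding ab by metis
qed

text \<open>No tile reaches the centre, so only the stopper is nonzero there.\<close>

lemma inner_on_centre:
  assumes d: "d = 2 * r + 1" and a: "a \<in> state_indices r" and b: "b \<in> state_indices r" and "a \<noteq> b"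
  shows "inner_on {(r, r)} (indexed_state d a) (indexed_state d b) = 0"
proof -
  obtain t1 q1 k1 t2 q2 k2 where ab: "a = (t1, q1, k1)" "b = (t2, q2, k2)"
    by (metis prod_cases3)
  have "k1 > 0 \<or> k2 > 0"
    using assms unfolding ab by (auto simp: state_indices_def)
  moreover have "indexed_state d (t, q, k) $$ (r, r) = 0" if "(t, q, k) \<in> state_indices r" "k > 0" for t q k
    using that d by (auto simp: state_indices_def tile_def)
  ultimately show ?thesis
    using a b unfolding ab inner_on_def by (auto simp del: indexed_state.simps)
qed

text \<open>A vanishing final state has probability 0, so nonzero probability supplies the
  non-vanishing that \<open>locc_separates\<close> asks for.\<close>

lemma locc_distinguishable_withI:
  assumes "locc_separates (dim_row \<Psi> * m) (dim_col \<Psi> * n) I (\<lambda>i. joint_state \<Psi> (\<psi> i))"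
  shows "locc_distinguishable_with \<Psi> m n (\<psi> ` I)"
proof -
  have "outcome_prob P xs \<phi> = 0" if "post_state P xs \<phi> = 0\<^sub>m a b" for P xs \<phi> a b
    using that by (simp add: outcome_prob_def state_inner_def)
  then have prob: "post_state P xs \<phi> \<noteq> 0\<^sub>m a b" if "outcome_prob P xs \<phi> \<noteq> 0" for P xs \<phi> a b
    using that by blast
  obtain P where P: "locc_protocol (dim_row \<Psi> * m) (dim_col \<Psi> * n) P"
    "\<And>xs i j. complete_outcomes P xs \<Longrightarrow> i \<in> I \<Longrightarrow> j \<in> I \<Longrightarrow>
       post_state P xs (joint_state \<Psi> (\<psi> i)) \<noteq> 0\<^sub>m (dim_row \<Psi> * m) (dim_col \<Psi> * n) \<Longrightarrow>
       post_state P xs (joint_state \<Psi> (\<psi> j)) \<noteq> 0\<^sub>m (dim_row \<Psi> * m) (dim_col \<Psi> * n) \<Longrightarrow> i = j"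
    using assms unfolding locc_separates_def by blast
  have "\<psi> i = \<psi> j"
    if "complete_outcomes P xs" "i \<in> I" "j \<in> I" "outcome_prob P xs (joint_state \<Psi> (\<psi> i)) \<noteq> 0"
      "outcome_prob P xs (joint_state \<Psi> (\<psi> j)) \<noteq> 0" for xs i j
    using P(2)[OF that(1-3) prob[OF that(4)] prob[OF that(5)]] by simp
  with P(1) show ?thesis
    unfolding locc_distinguishable_with_def by (intro exI[of _ P]) blast
qed

theorem theorem4:
  fixes d :: nat
  assumes "d \<ge> 3" and "odd d"
  shows "card (U_states d) = (d - 1)^2 + 1 \<and>
         orthogonal_states (U_states d) \<and>
         locc_distinguishable_with (bell_copies ((d - 1) div 2)) d d (U_states d)"
proof -
  obtain r where d: "d = 2 * r + 1" using \<open>odd d\<close> by (elim oddE)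
  have r: "r \<ge> 1" using \<open>d \<ge> 3\<close> d by simp
  have U: "U_states d = indexed_state d ` state_indices r"
    by (rule U_states_eq[OF d r])
  have "card (U_states d) = (d - 1)^2 + 1"
    unfolding U card_image[OF inj_indexed_state[OF d]] card_state_indices using d by simp
  moreover have "orthogonal_states (U_states d)"
    unfolding orthogonal_states_def U by (rule pairwise_imageI) (rule state_inner_indexed[OF d])
  moreover have "locc_distinguishable_with (bell_copies ((d - 1) div 2)) d d (U_states d)"
  proof -
    \<comment> \<open>The ancillas have dimension \<open>K = 2 ^ r\<close>, and
      \<open>r < 2 ^ r\<close> leaves room for the \<open>r + 1\<close> labels.\<close>
    have "locc_separates (2 ^ r * d) (2 ^ r * d) (state_indices r)
        (\<lambda>a. joint_state (1\<^sub>m (2 ^ r)) (indexed_state d a))"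
      by (rule locc_separates_tiled[OF finite_state_indices d less_exp indexed_state_carrier])
        (use inner_on_tile(1)[OF d] inner_on_centre[OF d] in auto)
    moreover have "bell_copies ((d - 1) div 2) = 1\<^sub>m (2 ^ r)"
      using d by (simp add: bell_copies_eq)
    ultimately show ?thesis
      unfolding U by (intro locc_distinguishable_withI) simp
  qed
  ultimately show ?thesis by blast
qed

end
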